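(* Let $E$ be a monotone complete partially ordered vector space that is also a normed space. Suppose that $E$ has the following properties: (1) if $x_\lambda\downarrow 0$ in $E$, then $\lVert x_\lambda\rVert\to 0$; (2) if $\{x_n\}_{n=1}^\infty\subset E^+$ is such that $\sum_{n=1}^\infty\lVert x_n\rVert<\infty$, then $\bigvee_{N=1}^\infty\sum_{n=1}^N x_n$, which exists in $\overline{E}$, is actually finite; (3) if $x\in E$ is such that $(x,x')\geq 0$ for all norm bounded positive $\sigma$-order continuous functionals $x'$ on $E$, then $x\in E^+$. Let $X$ be a non-empty locally compact Hausdorff space, and let $\pi:\mathrm{C}_{\mathrm c}(X)\to E$ be a positive operator. Then there exists a unique regular Borel measure $\mu:\mathscr{B}\to\overline{E^+}$ on the Borel $\sigma$-algebra $\mathscr{B}$ of $X$ such that \[ \pi(f)=\int_X^{\mathrm{o}} f\,\mathrm{d}\mu \] for all $f\in \mathrm{C}_{\mathrm c}(X)$. If $V$ is a non-empty open subset of $X$, then \[ \mu(V)=\bigvee\{\pi(f): f\prec V\} \] in $\overline{E}$. If $K$ is a compact subset of $X$, then \[ \mu(K)=\bigwedge\{\pi(f): K\prec f\} \] in $\overline{E}$. Hence $\mu$ is a finite measure if and only if $\{\pi(f): f\in \mathrm{C}_{\mathrm c}(X)^+,\ \lVert f\rVert\leq 1\}$ is bounded above in $E$; this is automatically the case if $X$ is compact. If $\mu$ is a finite measure and if the norm of $E$ is monotone on $E^+$, then $\pi$ is continuous with respect to the supremum norm topology on $\mathrm{C}_{\mathrm c}(X)$ and the norm topology on $E$; in this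 case, $\lVert\pi\rVert\leq 2\lVert\mu(X)\rVert$. If (still with $\mu$ finite) $E$ is a normed vector lattice, then it is a Banach lattice with an order continuous norm, and $\lVert\pi\rVert=\lVert\mu(X)\rVert$.
   Context: Ordered spaces. Vector spaces are real; operators and functionals are linear. A partially ordered vector space $E$ has a proper positive cone $E^+$ (i.e. $E^+\cap(-E^+)=\{0\}$), which need not be generating. Vector lattices are Archimedean. $E$ is monotone complete if every increasing net in $E$ that is bounded above has a supremum in $E$. $x_\lambda\downarrow x$ means that $(x_\lambda)$ is a decreasing net with infimum $x$; $x_\lambda\uparrow x$ is defined similarly. An operator $T$ between partially ordered vector spaces is positive if it maps the positive cone into the positive cone. A positive functional $x'$ on $E$ is $\sigma$-order continuous if $(x_n,x')\downarrow 0$ for every sequence $x_n\downarrow 0$ in $E$; $(x,x')$ denotes the value of $x'$ at $x$. Extended space. $\overline{E}=E\cup\{\infty\}$ (disjoint union), ordered by the order of $E$ and $x\le\infty$ for all $x\in\overline E$; $\overline{E^+}=E^+\cup\{\infty\}$; $\infty+x=x+\infty=\infty$; $r\cdot\infty=\infty$ for real $r>0$, $0\cdot\infty=0$. Elements of $E$ are called finite. Measures. A positive $\overline E$-valued measure on $\mathscr{B}$ is a map $\mu:\mathscr{B}\to\overline{E^+}$ with $\mu(\emptyset)=0$ and $\mu(\bigcup_n\Delta_n)=\bigvee_{N=1}^\infty\sum_{n=1}^N\mu(\Delta_n)$ in $\overline E$ for pairwise disjoint sequences $(\Delta_n)$ in $\mathscr{B}$. It is finite if $\mu(X)\in E^+$.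 Order integral. For a measurable $\varphi=\sum_{i=1}^n r_i\chi_{\Delta_i}\ge 0$ taking finitely many finite values ($r_i\in\mathbb{R}^+$, $\Delta_i\in\mathscr{B}$), $\int_X^{\mathrm o}\varphi\,\mathrm d\mu=\sum_i r_i\mu(\Delta_i)\in\overline{E^+}$. For measurable $f:X\to[0,\infty]$, $\int_X^{\mathrm o}f\,\mathrm d\mu=\bigvee_n\int_X^{\mathrm o}\varphi_n\,\mathrm d\mu$ in $\overline{E}$, for any sequence of such elementary functions $\varphi_n\uparrow f$ pointwise (independent of the choice). A measurable $f:X\to\mathbb{R}$ is integrable if $\int_X^{\mathrm o}|f|\,\mathrm d\mu$ is finite, and then $\int_X^{\mathrm o}f\,\mathrm d\mu=\int_X^{\mathrm o}f^+\,\mathrm d\mu-\int_X^{\mathrm o}f^-\,\mathrm d\mu$. Regularity. $\mu$ is a Borel measure if $\mu(K)\in E$ for all compact $K\subseteq X$; it is inner regular at $\Delta$ if $\mu(\Delta)=\bigvee\{\mu(K):K\text{ compact},K\subseteq\Delta\}$ in $\overline E$; outer regular at $\Delta$ if $\mu(\Delta)=\bigwedge\{\mu(V):V\text{ open},\Delta\subseteq V\}$ in $\overline E$. It is a regular Borel measure if it is a Borel measure that is inner regular at all open sets and outer regular at all Borel sets. Functions. $\mathrm{C}_{\mathrm c}(X)$ is the space of real-valued continuous functions on $X$ with compact support, with the pointwise order and the supremum norm. For $S\subseteq X$, $f\prec S$ means $f\in\mathrm{C}_{\mathrm c}(X)$, $0\le f\le 1$ and $\operatorname{supp}f\subseteq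 S$; $S\prec f$ means $f\in\mathrm{C}_{\mathrm c}(X)$, $0\le f\le 1$ and $f=1$ on $S$. The norm of $E$ is monotone on $E^+$ if $0\le x\le y$ implies $\lVert x\rVert\le\lVert y\rVert$. A Banach lattice has an order continuous norm if $x_\lambda\downarrow0$ implies $\lVert x_\lambda\rVert\to0$. *)

theory Defs
  imports "HOL-Analysis.Analysis" "HOL-Library.Lub_Glb"
begin

section \<open>Partially ordered vector spaces\<close>

text \<open>
  A partially ordered vector space is a type of class \<^class>\<open>ordered_real_vector\<close>; its positive cone
  is \<open>{0..}\<close>. Suprema and infima are expressed by the relations \<^const>\<open>isLub\<close> \<open>UNIV\<close> and
  \<^const>\<open>isGlb\<close> \<open>UNIV\<close>, since they need not exist.
\<close>

definition directed_index :: "'i set \<Rightarrow> ('i \<Rightarrow> 'i \<Rightarrow> bool) \<Rightarrow> bool" where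
  "directed_index I r \<longleftrightarrow>
     I \<noteq> {} \<and> reflp_on I r \<and> transp_on I r \<and> (\<forall>i\<in>I. \<forall>j\<in>I. \<exists>k\<in>I. r i k \<and> r j k)"

definition increasing_net :: "'i set \<Rightarrow> ('i \<Rightarrow> 'i \<Rightarrow> bool) \<Rightarrow> ('i \<Rightarrow> 'e::order) \<Rightarrow> bool" where
  "increasing_net I r x \<longleftrightarrow> directed_index I r \<and> monotone_on I r (\<le>) x"

definition decreasing_net :: "'i set \<Rightarrow> ('i \<Rightarrow> 'i \<Rightarrow> bool) \<Rightarrow> ('i \<Rightarrow> 'e::order) \<Rightarrow> bool" where
  "decreasing_net I r x \<longleftrightarrow> directed_index I r \<and> monotone_on I r (\<ge>) x"

text \<open>
  HOL cannot quantify over the type of the index set inside a formula. In the next two definitions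
  the indices are taken from \<open>'e\<close> itself; this covers nets over arbitrary index types, because a
  monotone net can be replaced by its range, directed by the order of \<open>'e\<close>: see
  \<open>monotone_complete_net\<close> and \<open>norm_order_continuous_net\<close> below.
\<close>

definition monotone_complete :: "'e::ordered_real_vector itself \<Rightarrow> bool" where
  "monotone_complete TYPE('e) \<longleftrightarrow>
     (\<forall>(I :: 'e set) r (x :: 'e \<Rightarrow> 'e).
        increasing_net I r x \<and> bdd_above (x ` I) \<longrightarrow> (\<exists>s. isLub UNIV (x ` I) s))"

definition norm_order_continuous :: "'e::{ordered_real_vector,real_normed_vector} itself \<Rightarrow> bool" where
  "norm_order_continuous TYPE('e) \<longleftrightarrow>
     (\<forall>(I :: 'e set) r (x :: 'e \<Rightarrow> 'e).
        decreasing_net I r x \<and> isGlb UNIV (x ` I) 0 \<longrightarrow>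
        (\<forall>\<epsilon>>0. \<exists>i\<in>I. \<forall>j\<in>I. r i j \<longrightarrow> norm (x j) < \<epsilon>))"

lemma directed_index_range:
  assumes "directed_index I r" "monotone_on I r R x" "reflp R" "transp R"
  shows "directed_index (x ` I) R"
  unfolding directed_index_def
proof (intro conjI ballI)
  show "x ` I \<noteq> {}" using assms(1) by (simp add: directed_index_def)
  show "reflp_on (x ` I) R" using assms(3) by (simp add: reflp_on_def)
  show "transp_on (x ` I) R" using assms(4) by (meson transp_on_subset subset_UNIV)
  fix y z assume "y \<in> x ` I" "z \<in> x ` I"
  then obtain i j where ij: "i \<in> I" "y = x i" "j \<in> I" "z = x j" by blast
  then obtain k where k: "k \<in> I" "r i k" "r j k"
    using assms(1) by (meson directed_index_def)
  then have "R y (x k)" "R z (x k)"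
    using assms(2) ij unfolding monotone_on_def by simp_all
  with k(1) show "\<exists>k\<in>x ` I. R y k \<and> R z k" by blast
qed

lemma monotone_complete_net:
  fixes x :: "'i \<Rightarrow> 'e::ordered_real_vector"
  assumes "monotone_complete TYPE('e)" "increasing_net I r x" "bdd_above (x ` I)"
  shows "\<exists>s. isLub UNIV (x ` I) s"
proof -
  have "directed_index (x ` I) (\<le>)"
    using assms(2) unfolding increasing_net_def by (intro directed_index_range[of I r]) auto
  then have "increasing_net (x ` I) (\<le>) id"
    by (simp add: increasing_net_def monotone_on_def)
  moreover have "bdd_above (id ` x ` I)"
    using assms(3) by simp
  ultimately have "\<exists>s. isLub UNIV (id ` x ` I) s"
    using assms(1) unfolding monotone_complete_def by blast
  then show ?thesis by simp
qed

lemma norm_order_continuous_net: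
  fixes x :: "'i \<Rightarrow> 'e::{ordered_real_vector,real_normed_vector}"
  assumes "norm_order_continuous TYPE('e)" "decreasing_net I r x" "isGlb UNIV (x ` I) 0" "\<epsilon> > 0"
  shows "\<exists>i\<in>I. \<forall>j\<in>I. r i j \<longrightarrow> norm (x j) < \<epsilon>"
proof -
  have "directed_index (x ` I) (\<ge>)"
    using assms(2) unfolding decreasing_net_def by (intro directed_index_range[of I r]) auto
  then have "decreasing_net (x ` I) (\<ge>) id"
    by (simp add: decreasing_net_def monotone_on_def)
  moreover have "isGlb UNIV (id ` x ` I) 0"
    using assms(3) by simp
  ultimately have "\<exists>y\<in>x ` I. \<forall>z\<in>x ` I. y \<ge> z \<longrightarrow> norm (id z) < \<epsilon>"
    using assms(1,4) unfolding norm_order_continuous_def by blast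
  then obtain i where i: "i \<in> I" "\<And>j. j \<in> I \<Longrightarrow> x j \<le> x i \<Longrightarrow> norm (x j) < \<epsilon>"
    by auto
  moreover have "x j \<le> x i" if "j \<in> I" "r i j" for j
    using assms(2) i(1) that unfolding decreasing_net_def monotone_on_def by blast
  ultimately show ?thesis by blast
qed

definition positive_operator ::
    "('a::ordered_real_vector \<Rightarrow> 'b::ordered_real_vector) \<Rightarrow> bool" where
  "positive_operator T \<longleftrightarrow> linear T \<and> (\<forall>x\<ge>0. T x \<ge> 0)"

definition \<sigma>_order_continuous :: "('e::ordered_real_vector \<Rightarrow> real) \<Rightarrow> bool" where
  "\<sigma>_order_continuous x' \<longleftrightarrow>
     (\<forall>x :: nat \<Rightarrow> 'e. decseq x \<and> isGlb UNIV (range x) 0 \<longrightarrow>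
        decseq (\<lambda>n. x' (x n)) \<and> isGlb UNIV (range (\<lambda>n. x' (x n))) 0)"

definition norm_monotone_on_cone :: "'e::{ordered_real_vector,real_normed_vector} itself \<Rightarrow> bool" where
  "norm_monotone_on_cone TYPE('e) \<longleftrightarrow> (\<forall>x y :: 'e. 0 \<le> x \<and> x \<le> y \<longrightarrow> norm x \<le> norm y)"

text \<open>Vector lattices are Archimedean by convention.\<close>

definition vector_lattice :: "'e::ordered_real_vector itself \<Rightarrow> bool" where
  "vector_lattice TYPE('e) \<longleftrightarrow>
     (\<forall>x y :: 'e. (\<exists>s. isLub UNIV {x, y} s) \<and> (\<exists>i. isGlb UNIV {x, y} i)) \<and>
     (\<forall>x :: 'e. x \<ge> 0 \<longrightarrow> isGlb UNIV (range (\<lambda>n. (1 / real (Suc n)) *\<^sub>R x)) 0)"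

text \<open>
  In the lattice norm axiom, \<open>a\<close> and \<open>b\<close> are the absolute values \<open>x \<or> (- x)\<close> and \<open>y \<or> (- y)\<close>.
\<close>

definition normed_vector_lattice :: "'e::{ordered_real_vector,real_normed_vector} itself \<Rightarrow> bool" where
  "normed_vector_lattice TYPE('e) \<longleftrightarrow>
     vector_lattice TYPE('e) \<and>
     (\<forall>x y a b :: 'e. isLub UNIV {x, - x} a \<and> isLub UNIV {y, - y} b \<and> a \<le> b \<longrightarrow> norm x \<le> norm y)"

definition banach_lattice :: "'e::{ordered_real_vector,real_normed_vector} itself \<Rightarrow> bool" where
  "banach_lattice TYPE('e) \<longleftrightarrow> normed_vector_lattice TYPE('e) \<and> complete (UNIV :: 'e set)"


section \<open>The extended space\<close>

datatype 'e with_inf = is_finite: Fin (fin_part: 'e) | Infty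

instantiation with_inf :: (order) order
begin

definition less_eq_with_inf :: "'a with_inf \<Rightarrow> 'a with_inf \<Rightarrow> bool" where
  "x \<le> y \<longleftrightarrow> (case y of Infty \<Rightarrow> True | Fin b \<Rightarrow> (case x of Infty \<Rightarrow> False | Fin a \<Rightarrow> a \<le> b))"

definition less_with_inf :: "'a with_inf \<Rightarrow> 'a with_inf \<Rightarrow> bool" where
  "x < y \<longleftrightarrow> x \<le> y \<and> \<not> y \<le> (x :: 'a with_inf)"

instance
  by standard (auto simp: less_eq_with_inf_def less_with_inf_def split: with_inf.splits)

end

instantiation with_inf :: (comm_monoid_add) comm_monoid_add
begin

definition zero_with_inf :: "'a with_inf" where
  "0 = Fin 0"

definition plus_with_inf :: "'a with_inf \<Rightarrow> 'a with_inf \<Rightarrow> 'a with_inf" where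
  "x + y = (case x of Infty \<Rightarrow> Infty | Fin a \<Rightarrow> (case y of Infty \<Rightarrow> Infty | Fin b \<Rightarrow> Fin (a + b)))"

instance
  by standard (auto simp: zero_with_inf_def plus_with_inf_def ac_simps split: with_inf.splits)

end

text \<open>Only meant for scalars \<open>r \<ge> 0\<close>.\<close>

definition scale_inf :: "real \<Rightarrow> 'e::real_vector with_inf \<Rightarrow> 'e with_inf" where
  "scale_inf r x = (case x of Fin a \<Rightarrow> Fin (r *\<^sub>R a) | Infty \<Rightarrow> if r = 0 then 0 else Infty)"


section \<open>Measures with values in the extended positive cone\<close>

text \<open>
  For a measurable space \<open>M\<close> (the measure carried by \<open>M\<close> plays no role), the extended positive cone
  is \<open>{0..}\<close> in \<^typ>\<open>'e with_inf\<close>. Using \<^const>\<open>PiE\<close> makes a map defined on \<^term>\<open>sets M\<close> only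
  into an object that is determined by its values there, so that \<open>\<exists>!\<close> has its usual meaning.
\<close>

definition positive_measure :: "'x measure \<Rightarrow> ('x set \<Rightarrow> 'e::ordered_real_vector with_inf) \<Rightarrow> bool" where
  "positive_measure M \<mu> \<longleftrightarrow>
     \<mu> \<in> sets M \<rightarrow>\<^sub>E {0..} \<and> \<mu> {} = 0 \<and>
     (\<forall>\<Delta> :: nat \<Rightarrow> 'x set. range \<Delta> \<subseteq> sets M \<and> disjoint_family \<Delta> \<longrightarrow>
        isLub UNIV (range (\<lambda>N. \<Sum>n\<le>N. \<mu> (\<Delta> n))) (\<mu> (\<Union>n. \<Delta> n)))"

text \<open>
  An elementary function is represented by its distinct values and their preimages, as in
  \<^const>\<open>simple_integral\<close>.
\<close>

definition elementary :: "'x measure \<Rightarrow> ('x \<Rightarrow> real) \<Rightarrow> bool" where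
  "elementary M \<phi> \<longleftrightarrow> simple_function M \<phi> \<and> (\<forall>x\<in>space M. 0 \<le> \<phi> x)"

definition elementary_integral ::
    "'x measure \<Rightarrow> ('x set \<Rightarrow> 'e::ordered_real_vector with_inf) \<Rightarrow> ('x \<Rightarrow> real) \<Rightarrow> 'e with_inf" where
  "elementary_integral M \<mu> \<phi> =
     (\<Sum>r\<in>\<phi> ` space M. scale_inf r (\<mu> (\<phi> -` {r} \<inter> space M)))"

definition elementary_approx :: "'x measure \<Rightarrow> (nat \<Rightarrow> 'x \<Rightarrow> real) \<Rightarrow> ('x \<Rightarrow> ennreal) \<Rightarrow> bool" where
  "elementary_approx M \<phi> f \<longleftrightarrow>
     (\<forall>n. elementary M (\<phi> n)) \<and>
     (\<forall>x\<in>space M. incseq (\<lambda>n. \<phi> n x) \<and> (\<lambda>n. ennreal (\<phi> n x)) \<longlonglongrightarrow> f x)"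

text \<open>
  The integral of a measurable function with values in \<open>[0, \<infinity>]\<close> is the supremum produced by any
  approximating sequence; that it does not depend on the sequence is a property of
  \<^const>\<open>positive_measure\<close>s on monotone complete spaces.
\<close>

definition nn_order_integral ::
    "'x measure \<Rightarrow> ('x set \<Rightarrow> 'e::ordered_real_vector with_inf) \<Rightarrow> ('x \<Rightarrow> ennreal) \<Rightarrow> 'e with_inf" where
  "nn_order_integral M \<mu> f =
     (THE s. \<forall>\<phi>. elementary_approx M \<phi> f \<longrightarrow>
        isLub UNIV (range (\<lambda>n. elementary_integral M \<mu> (\<phi> n))) s)"

definition order_integrable ::
    "'x measure \<Rightarrow> ('x set \<Rightarrow> 'e::ordered_real_vector with_inf) \<Rightarrow> ('x \<Rightarrow> real) \<Rightarrow> bool" where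
  "order_integrable M \<mu> f \<longleftrightarrow>
     f \<in> borel_measurable M \<and> is_finite (nn_order_integral M \<mu> (\<lambda>x. ennreal \<bar>f x\<bar>))"

definition order_integral ::
    "'x measure \<Rightarrow> ('x set \<Rightarrow> 'e::ordered_real_vector with_inf) \<Rightarrow> ('x \<Rightarrow> real) \<Rightarrow> 'e" where
  "order_integral M \<mu> f =
     fin_part (nn_order_integral M \<mu> (\<lambda>x. ennreal (max (f x) 0))) -
     fin_part (nn_order_integral M \<mu> (\<lambda>x. ennreal (max (- f x) 0)))"


section \<open>Regular Borel measures\<close>

definition inner_regular_at ::
    "('x::topological_space set \<Rightarrow> 'e::ordered_real_vector with_inf) \<Rightarrow> 'x set \<Rightarrow> bool" where
  "inner_regular_at \<mu> \<Delta> \<longleftrightarrow> isLub UNIV {\<mu> K |K. compact K \<and> K \<subseteq> \<Delta>} (\<mu> \<Delta>)"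

definition outer_regular_at ::
    "('x::topological_space set \<Rightarrow> 'e::ordered_real_vector with_inf) \<Rightarrow> 'x set \<Rightarrow> bool" where
  "outer_regular_at \<mu> \<Delta> \<longleftrightarrow> isGlb UNIV {\<mu> V |V. open V \<and> \<Delta> \<subseteq> V} (\<mu> \<Delta>)"

definition regular_borel_measure ::
    "('x::topological_space set \<Rightarrow> 'e::ordered_real_vector with_inf) \<Rightarrow> bool" where
  "regular_borel_measure \<mu> \<longleftrightarrow>
     positive_measure borel \<mu> \<and>
     (\<forall>K. compact K \<longrightarrow> is_finite (\<mu> K)) \<and>
     (\<forall>V. open V \<longrightarrow> inner_regular_at \<mu> V) \<and>
     (\<forall>\<Delta>\<in>sets borel. outer_regular_at \<mu> \<Delta>)"


section \<open>Continuous functions with compact support\<close>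

text \<open>\<open>'x cc\<close> carries the pointwise order and the supremum norm.\<close>

typedef (overloaded) 'x cc =
    "{f :: 'x::topological_space \<Rightarrow> real. continuous_on UNIV f \<and> compact (closure {x. f x \<noteq> 0})}"
  morphisms apply_cc Abs_cc
  by (rule exI[of _ "\<lambda>_. 0"]) simp

setup_lifting type_definition_cc

lemma cc_eqI: "(\<And>x. apply_cc f x = apply_cc g x) \<Longrightarrow> f = g"
  by (metis apply_cc_inject ext)

lemma continuous_on_cc: "continuous_on S (apply_cc f)"
  using apply_cc[of f] by (auto intro: continuous_on_subset)

lemma compact_support_cc: "compact (closure {x. apply_cc f x \<noteq> 0})"
  using apply_cc[of f] by auto

lemma compact_support_subset:
  fixes f g :: "'x::topological_space \<Rightarrow> real"
  assumes "compact (closure {x. f x \<noteq> 0})" "compact (closure {x. g x \<noteq> 0})"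
    and "\<And>x. f x = 0 \<Longrightarrow> g x = 0 \<Longrightarrow> h x = (0 :: real)"
  shows "compact (closure {x. h x \<noteq> 0})"
proof -
  have "{x. h x \<noteq> 0} \<subseteq> {x. f x \<noteq> 0} \<union> {x. g x \<noteq> 0}"
    using assms(3) by auto
  then have "closure {x. h x \<noteq> 0} \<subseteq> closure {x. f x \<noteq> 0} \<union> closure {x. g x \<noteq> 0}"
    by (simp flip: closure_Un add: closure_mono)
  then show ?thesis
    using compact_Int_closed[OF compact_Un[OF assms(1,2)] closed_closure[of "{x. h x \<noteq> 0}"]]
    by (simp add: Int_absorb1)
qed

lemma
  fixes f g :: "'x::topological_space \<Rightarrow> real"
  assumes f: "compact (closure {x. f x \<noteq> 0})"
  shows compact_support_add:
      "compact (closure {x. g x \<noteq> 0}) \<Longrightarrow> compact (closure {x. f x + g x \<noteq> 0})"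
    and compact_support_diff:
      "compact (closure {x. g x \<noteq> 0}) \<Longrightarrow> compact (closure {x. f x - g x \<noteq> 0})"
    and compact_support_scale: "compact (closure {x. r * f x \<noteq> 0})"
  by (rule compact_support_subset[OF f], assumption, simp)
    (rule compact_support_subset[OF f], assumption, simp,
      rule compact_support_subset[OF f f], simp)

lemma bounded_cc: "bounded (range (apply_cc f))"
proof -
  have "range (apply_cc f) \<subseteq> insert 0 (apply_cc f ` closure {x. apply_cc f x \<noteq> 0})"
    using closure_subset[of "{x. apply_cc f x \<noteq> 0}"] by auto
  moreover have "bounded (apply_cc f ` closure {x. apply_cc f x \<noteq> 0})"
    by (intro compact_imp_bounded compact_continuous_image continuous_on_cc compact_support_cc)
  ultimately show ?thesis
    by (meson bounded_insert bounded_subset)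
qed

instantiation cc :: (topological_space) real_vector
begin

lift_definition zero_cc :: "'a cc" is "\<lambda>_. 0" by simp

lift_definition plus_cc :: "'a cc \<Rightarrow> 'a cc \<Rightarrow> 'a cc" is "\<lambda>f g x. f x + g x"
  by (blast intro: continuous_on_add compact_support_add)

lift_definition minus_cc :: "'a cc \<Rightarrow> 'a cc \<Rightarrow> 'a cc" is "\<lambda>f g x. f x - g x"
  by (blast intro: continuous_on_diff compact_support_diff)

lift_definition uminus_cc :: "'a cc \<Rightarrow> 'a cc" is "\<lambda>f x. - f x"
  by (simp add: continuous_on_minus)

lift_definition scaleR_cc :: "real \<Rightarrow> 'a cc \<Rightarrow> 'a cc" is "\<lambda>r f x. r * f x"
  by (blast intro: continuous_on_mult_left compact_support_scale)

instance
  by standard (rule cc_eqI;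
    simp add: zero_cc.rep_eq plus_cc.rep_eq minus_cc.rep_eq uminus_cc.rep_eq scaleR_cc.rep_eq algebra_simps)+

end

instantiation cc :: (topological_space) ordered_real_vector
begin

lift_definition less_eq_cc :: "'a cc \<Rightarrow> 'a cc \<Rightarrow> bool" is "\<lambda>f g. \<forall>x. f x \<le> g x" .

definition less_cc :: "'a cc \<Rightarrow> 'a cc \<Rightarrow> bool" where
  "f < g \<longleftrightarrow> f \<le> g \<and> \<not> g \<le> (f :: 'a cc)"

instance
proof
  fix f g h :: "'a cc" and a b :: real
  show "f < g \<longleftrightarrow> f \<le> g \<and> \<not> g \<le> f" by (rule less_cc_def)
  show "f \<le> f" by (simp add: less_eq_cc.rep_eq)
  show "f \<le> g \<Longrightarrow> g \<le> h \<Longrightarrow> f \<le> h"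
    unfolding less_eq_cc.rep_eq by (meson order_trans)
  show "f \<le> g \<Longrightarrow> g \<le> f \<Longrightarrow> f = g"
    by (rule cc_eqI) (simp add: less_eq_cc.rep_eq order_antisym)
  show "f \<le> g \<Longrightarrow> h + f \<le> h + g"
    by (simp add: less_eq_cc.rep_eq plus_cc.rep_eq)
  show "f \<le> g \<Longrightarrow> 0 \<le> a \<Longrightarrow> a *\<^sub>R f \<le> a *\<^sub>R g"
    by (simp add: less_eq_cc.rep_eq scaleR_cc.rep_eq mult_left_mono)
  show "a \<le> b \<Longrightarrow> 0 \<le> f \<Longrightarrow> a *\<^sub>R f \<le> b *\<^sub>R f"
    by (simp add: less_eq_cc.rep_eq scaleR_cc.rep_eq zero_cc.rep_eq mult_right_mono)
qed

end

instantiation cc :: (topological_space) real_normed_vector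
begin

lift_definition norm_cc :: "'a cc \<Rightarrow> real" is "\<lambda>f. SUP x. \<bar>f x\<bar>" .

definition dist_cc :: "'a cc \<Rightarrow> 'a cc \<Rightarrow> real" where
  "dist_cc f g = norm (f - g)"

definition sgn_cc :: "'a cc \<Rightarrow> 'a cc" where
  "sgn_cc f = inverse (norm f) *\<^sub>R f"

definition uniformity_cc :: "('a cc \<times> 'a cc) filter" where
  "uniformity_cc = (INF e\<in>{0<..}. principal {(f, g). dist f g < e})"

definition open_cc :: "'a cc set \<Rightarrow> bool" where
  "open_cc S \<longleftrightarrow> (\<forall>f\<in>S. \<forall>\<^sub>F (f', g) in uniformity. f' = f \<longrightarrow> g \<in> S)"

lemma cc_abs_le_norm: "\<bar>apply_cc f x\<bar> \<le> norm f"
proof -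
  have "bdd_above (range (\<lambda>x. \<bar>apply_cc f x\<bar>))"
    using bounded_cc[of f] by (auto simp: bounded_iff bdd_above_def)
  then show ?thesis
    unfolding norm_cc.rep_eq by (intro cSUP_upper) auto
qed

lemma cc_norm_le: "(\<And>x. \<bar>apply_cc f x\<bar> \<le> c) \<Longrightarrow> norm f \<le> c"
  unfolding norm_cc.rep_eq by (intro cSUP_least) auto

instance
proof
  fix f g :: "'a cc" and a :: real
  show "dist f g = norm (f - g)" by (rule dist_cc_def)
  show "sgn f = inverse (norm f) *\<^sub>R f" by (rule sgn_cc_def)
  show "uniformity = (INF e\<in>{0<..}. principal {(f :: 'a cc, g). dist f g < e})"
    by (rule uniformity_cc_def)
  show "open U \<longleftrightarrow> (\<forall>f\<in>U. \<forall>\<^sub>F (f', g) in uniformity. f' = f \<longrightarrow> g \<in> U)" for U :: "'a cc set"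
    by (rule open_cc_def)
  show "norm f = 0 \<longleftrightarrow> f = 0"
  proof
    assume "norm f = 0"
    then have "apply_cc f x = 0" for x
      using cc_abs_le_norm[of f x] by simp
    then show "f = 0"
      by (intro cc_eqI) (simp add: zero_cc.rep_eq)
  qed (simp add: norm_cc.rep_eq zero_cc.rep_eq)
  show "norm (f + g) \<le> norm f + norm g"
  proof (rule cc_norm_le)
    fix x
    show "\<bar>apply_cc (f + g) x\<bar> \<le> norm f + norm g"
      using cc_abs_le_norm[of f x] cc_abs_le_norm[of g x] by (simp add: plus_cc.rep_eq)
  qed
  have le: "norm (a *\<^sub>R f) \<le> \<bar>a\<bar> * norm f" for a and f :: "'a cc"
    by (rule cc_norm_le) (simp add: scaleR_cc.rep_eq abs_mult mult_left_mono cc_abs_le_norm)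
  show "norm (a *\<^sub>R f) = \<bar>a\<bar> * norm f"
  proof (cases "a = 0")
    case True
    then show ?thesis by (simp add: norm_cc.rep_eq zero_cc.rep_eq)
  next
    case False
    then have "\<bar>a\<bar> * norm f \<le> norm (a *\<^sub>R f)"
      using le[of "inverse a" "a *\<^sub>R f"] by (simp add: field_simps)
    with le[of a f] show ?thesis by simp
  qed
qed

end

definition prec_below :: "'x::topological_space cc \<Rightarrow> 'x set \<Rightarrow> bool" (infix \<open>\<prec>\<^sub>s\<close> 50) where
  "f \<prec>\<^sub>s S \<longleftrightarrow> (\<forall>x. 0 \<le> apply_cc f x \<and> apply_cc f x \<le> 1) \<and> closure {x. apply_cc f x \<noteq> 0} \<subseteq> S"

definition prec_above :: "'x::topological_space set \<Rightarrow> 'x cc \<Rightarrow> bool" (infix \<open>\<prec>\<^sub>f\<close> 50) where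
  "S \<prec>\<^sub>f f \<longleftrightarrow> (\<forall>x. 0 \<le> apply_cc f x \<and> apply_cc f x \<le> 1) \<and> (\<forall>x\<in>S. apply_cc f x = 1)"

definition represents ::
    "('x::topological_space set \<Rightarrow> 'e::ordered_real_vector with_inf) \<Rightarrow> ('x cc \<Rightarrow> 'e) \<Rightarrow> bool" where
  "represents \<mu> \<pi> \<longleftrightarrow>
     regular_borel_measure \<mu> \<and>
     (\<forall>f. order_integrable borel \<mu> (apply_cc f) \<and> \<pi> f = order_integral borel \<mu> (apply_cc f))"

end

(*
  Testing against the norm bounded positive \<sigma>-order continuous functionals x' on E, which determine the
  order of E, reduces the theorem to the scalar Riesz representation theorem for the functionals
  x' o \<pi>. For V open with { \<pi> f | f \<prec> V } bounded above, the order continuity of the norm makes x' commute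
  with the supremum of that set, so that it is a common lift to E of the scalar measures of V; the same
  holds for the infimum that defines the measure of any set contained in such a V. Countable additivity is
  then scalar additivity, once it is known that a union is contained in such a V as soon as the partial
  sums of the measures are bounded above; this is what summability of norms is needed for.
*)
theory Submission
  imports Defs
begin

text \<open>The scalar measures do not decide where the vector measure is finite. For the inclusion
  of the finitely supported sequences into the null sequences, every \<open>x'\<close> yields a
  finite total mass, yet the sequences with values in [0, 1] have no common upper bound. Finiteness
  is therefore a condition of its own: to lie in an open set \<open>V\<close> with
  \<open>below V\<close> order bounded. Scalar values are lifted to the ordered space only within
  such sets; every other Borel set gets \<open>Infty\<close>.

  Scalars are compared in \<open>ennreal\<close>, where suprema, infima and series always exist. The
  price is that negative numbers become 0, whence the sign conditions that accompany the
  comparisons.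

  Uniqueness does not compare scalar measures. For any representing measure, the values on open sets
  are suprema of elements \<open>\<pi> f\<close>, and outer regularity yields the others. This
  computation also gives the formulas for open and compact sets and, for \<open>UNIV\<close>, the
  starting point of all statements on finite measures.\<close>

lemma isLub_UNIV_iff: "isLub UNIV S s \<longleftrightarrow> (\<forall>y\<in>S. y \<le> s) \<and> (\<forall>u. (\<forall>y\<in>S. y \<le> u) \<longrightarrow> s \<le> u)"
  by (auto simp: isLub_def leastP_def isUb_def setle_def setge_def)

lemma isGlb_UNIV_iff: "isGlb UNIV S s \<longleftrightarrow> (\<forall>y\<in>S. s \<le> y) \<and> (\<forall>u. (\<forall>y\<in>S. u \<le> y) \<longrightarrow> u \<le> s)"
  by (auto simp: isGlb_def greatestP_def isLb_def setle_def setge_def)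

section \<open>Urysohn functions with compact support\<close>

lemma Hausdorff_space_t2: "Hausdorff_space (euclidean :: 'x::t2_space topology)"
  using hausdorff unfolding Hausdorff_space_def disjnt_def open_openin[symmetric] by blast

text \<open>In a Hausdorff space \<open>K\<close> is closed, so the closure of the set where
  \<open>h\<close> is nonzero stays inside \<open>K\<close>. Products, maxima and truncations of
  functions are turned into elements of \<open>'x cc\<close> in this way.\<close>

lemma cc_exists:
  fixes h :: "'x::t2_space \<Rightarrow> real"
  assumes "continuous_on UNIV h" "compact K" "\<And>x. x \<notin> K \<Longrightarrow> h x = 0"
  shows "\<exists>g. apply_cc g = h"
proof -
  have "closure {x. h x \<noteq> 0} \<subseteq> K"
    using assms by (intro closure_minimal compact_imp_closed) auto
  then have "compact (closure {x. h x \<noteq> 0})"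
    using assms(2) by (metis closed_Int_compact closed_closure inf.absorb1)
  with assms(1) show ?thesis
    by (intro exI[of _ "Abs_cc h"] Abs_cc_inverse) auto
qed

text \<open>Each point of \<open>K\<close> has an open neighbourhood with compact closure inside
  \<open>V\<close>. Finitely many of them cover \<open>K\<close>, and the closure of a finite union
  is the union of the closures.\<close>

lemma locally_compact_separation:
  fixes K V :: "'x::t2_space set"
  assumes lc: "locally_compact_space (euclidean :: 'x topology)"
    and "compact K" "open V" "K \<subseteq> V"
  obtains W where "open W" "K \<subseteq> W" "compact (closure W)" "closure W \<subseteq> V"
proof -
  have "neighbourhood_base_of (\<lambda>C. compact C \<and> closed C) (euclidean :: 'x topology)"
    using lc locally_compact_space_neighbourhood_base_closedin[of "euclidean :: 'x topology"]
      Hausdorff_space_t2[where 'x='x]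
    by simp
  then have nb: "\<exists>U C. open U \<and> compact C \<and> closed C \<and> x \<in> U \<and> U \<subseteq> C \<and> C \<subseteq> V" if "x \<in> K" for x
    using assms(3,4) that unfolding neighbourhood_base_of open_openin[symmetric] by fast
  have "\<exists>U. open U \<and> x \<in> U \<and> compact (closure U) \<and> closure U \<subseteq> V" if x: "x \<in> K" for x
  proof -
    obtain U C where U: "open U" "compact C" "closed C" "x \<in> U" "U \<subseteq> C" "C \<subseteq> V" using nb[OF x] by blast
    then have "closure U \<subseteq> C" by (simp add: closure_minimal)
    with U show ?thesis
      by (metis closed_Int_compact closed_closure inf.absorb1 order_trans)
  qed
  then obtain U where U: "\<And>x. x \<in> K \<Longrightarrow> open (U x) \<and> x \<in> U x \<and> compact (closure (U x)) \<and> closure (U x) \<subseteq> V"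
    by metis
  obtain D where D: "D \<subseteq> K" "finite D" "K \<subseteq> (\<Union>x\<in>D. U x)"
    using compactE_image[OF assms(2), of K U] U by blast
  have cl: "closure (\<Union>x\<in>D. U x) = (\<Union>x\<in>D. closure (U x))"
    using D(2) by (induction D) auto
  show thesis
  proof (rule that)
    show "open (\<Union>x\<in>D. U x)" using D U by blast
    show "compact (closure (\<Union>x\<in>D. U x))"
      unfolding cl using compact_UN[OF D(2), of "\<lambda>x. closure (U x)"] D(1) U by blast
    show "closure (\<Union>x\<in>D. U x) \<subseteq> V"
      unfolding cl using D U by blast
  qed (fact D)
qed

text \<open>Two nested neighbourhoods are used. The separating function vanishes off
  \<open>W1\<close>, so its support lies in \<open>closure W1\<close> and hence in \<open>V\<close>;
  it is 1 on all of \<open>W\<close>, not only on \<open>K\<close>, so that \<open>1 - g\<close>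
  vanishes near \<open>K\<close>.\<close>

lemma cc_urysohn:
  fixes K V :: "'x::t2_space set"
  assumes lc: "locally_compact_space (euclidean :: 'x topology)"
    and "compact K" "open V" "K \<subseteq> V"
  obtains g W where "open W" "K \<subseteq> W" "W \<prec>\<^sub>f g" "g \<prec>\<^sub>s V"
proof -
  obtain W1 where W1: "open W1" "K \<subseteq> W1" "compact (closure W1)" "closure W1 \<subseteq> V"
    using locally_compact_separation[OF assms] .
  obtain W where W: "open W" "K \<subseteq> W" "compact (closure W)" "closure W \<subseteq> W1"
    using locally_compact_separation[OF lc assms(2) W1(1,2)] .
  have "completely_regular_space (euclidean :: 'x topology)"
    using lc locally_compact_regular_imp_completely_regular_space Hausdorff_space_t2[where 'x='x] by blast
  then obtain f :: "'x \<Rightarrow> real" where f: "continuous_map euclidean (top_of_set {0..1}) f"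
      "f ` (- W1) \<subseteq> {0}" "f ` closure W \<subseteq> {1}"
    using Urysohn_completely_regular_compact_closed[of 0 1 "euclidean :: 'x topology" "closure W" "- W1"]
      W W1(1) by (auto simp: disjnt_def)
  have cont: "continuous_on UNIV f" and f01: "\<And>x. 0 \<le> f x" "\<And>x. f x \<le> 1"
    using f(1) by (auto simp: continuous_map_in_subtopology)
  have f0: "f x = 0" if "x \<notin> W1" for x using f(2) that by blast
  obtain g where g: "apply_cc g = f"
    using cc_exists[OF cont W1(3)] f0 closure_subset by blast
  have "closure {x. f x \<noteq> 0} \<subseteq> closure W1"
    using f0 by (intro closure_mono) blast
  then have "g \<prec>\<^sub>s V"
    using W1(4) f01 by (auto simp: prec_below_def g)
  moreover have "W \<prec>\<^sub>f g"
    using f(3) closure_subset[of W] f01 by (force simp: prec_above_def g)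
  ultimately show thesis using that W by blast
qed

lemma prec_above_mono: "S \<subseteq> T \<Longrightarrow> T \<prec>\<^sub>f g \<Longrightarrow> S \<prec>\<^sub>f g"
  by (auto simp: prec_above_def)

lemma prec_below_mono: "S \<subseteq> T \<Longrightarrow> g \<prec>\<^sub>s S \<Longrightarrow> g \<prec>\<^sub>s T"
  by (auto simp: prec_below_def)

lemma apply_cc_sum: "apply_cc (\<Sum>i\<in>I. f i) x = (\<Sum>i\<in>I. apply_cc (f i) x)"
  by (induction I rule: infinite_finite_induct) (auto simp: zero_cc.rep_eq plus_cc.rep_eq)

lemma zero_prec_below [simp]: "0 \<prec>\<^sub>s S"
  by (simp add: prec_below_def zero_cc.rep_eq)

lemma prec_below_empty_iff [simp]: "f \<prec>\<^sub>s {} \<longleftrightarrow> f = 0"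
proof
  assume "f \<prec>\<^sub>s {}"
  then show "f = 0" by (intro cc_eqI) (auto simp: prec_below_def zero_cc.rep_eq)
qed simp

lemma measurable_cc [measurable]: "apply_cc f \<in> borel_measurable borel"
  by (intro borel_measurable_continuous_onI continuous_on_cc)

lemma cc_zero_outside: "x \<notin> closure {x. apply_cc f x \<noteq> 0} \<Longrightarrow> apply_cc f x = 0"
  using closure_subset[of "{x. apply_cc f x \<noteq> 0}"] by blast

lemma cc_pos_part: "\<exists>g. \<forall>x. apply_cc g x = max (apply_cc f x) 0" for f :: "'x::t2_space cc"
proof -
  have "continuous_on UNIV (\<lambda>x. max (apply_cc f x) 0)"
    by (intro continuous_on_max continuous_on_const continuous_on_cc)
  moreover have "max (apply_cc f x) 0 = 0" if "x \<notin> closure {x. apply_cc f x \<noteq> 0}" for x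
    using cc_zero_outside[OF that] by simp
  ultimately obtain g where "apply_cc g = (\<lambda>x. max (apply_cc f x) 0)"
    using cc_exists[OF _ compact_support_cc[of f]] by blast
  then show ?thesis by (intro exI[of _ g]) simp
qed

text \<open>The summand is the slice of \<open>t\<close> between the heights \<open>k\<close> and
  \<open>k + 1\<close>.\<close>

lemma sum_unit_layers:
  fixes t :: real
  assumes "0 \<le> t"
  shows "(\<Sum>k<N. min (max (t - real k) 0) 1) = min t (real N)"
  using assms by (induction N) (auto simp: min_def max_def)

section \<open>Positive functionals\<close>

locale positive_functional =
  fixes \<Lambda> :: "'x::t2_space cc \<Rightarrow> real"
  assumes lc: "locally_compact_space (euclidean :: 'x topology)"
    and pos: "positive_operator \<Lambda>"
begin

lemma linear: "linear \<Lambda>"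
  using pos by (simp add: positive_operator_def)

lemmas add = linear_add[OF linear] and diff = linear_diff[OF linear]
  and scale = linear_scale[OF linear] and zero = linear_0[OF linear]

lemma mono: "f \<le> g \<Longrightarrow> \<Lambda> f \<le> \<Lambda> g"
  using pos diff[of g f] unfolding positive_operator_def by (metis diff_ge_0_iff_ge)

lemma nonneg: "0 \<le> f \<Longrightarrow> 0 \<le> \<Lambda> f"
  using pos by (simp add: positive_operator_def)

lemma nonneg_prec_below: "f \<prec>\<^sub>s S \<Longrightarrow> 0 \<le> \<Lambda> f"
  by (rule nonneg) (simp add: prec_below_def less_eq_cc.rep_eq zero_cc.rep_eq)

section \<open>Contents of open sets and the outer measure they induce\<close>

definition open_content :: "'x set \<Rightarrow> ennreal" where
  "open_content V = (SUP f\<in>{f. f \<prec>\<^sub>s V}. ennreal (\<Lambda> f))"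

definition outer_content :: "'x set \<Rightarrow> ennreal" where
  "outer_content A = (INF V\<in>{V. open V \<and> A \<subseteq> V}. open_content V)"

lemma open_content_upper: "f \<prec>\<^sub>s V \<Longrightarrow> ennreal (\<Lambda> f) \<le> open_content V"
  unfolding open_content_def by (intro SUP_upper) auto

lemma open_content_mono: "U \<subseteq> V \<Longrightarrow> open_content U \<le> open_content V"
  unfolding open_content_def by (intro SUP_subset_mono) (auto intro: prec_below_mono)

lemma outer_content_open: "open V \<Longrightarrow> outer_content V = open_content V"
  unfolding outer_content_def
  by (intro antisym INF_lower INF_greatest) (auto intro: open_content_mono)

lemma outer_content_mono: "A \<subseteq> B \<Longrightarrow> outer_content A \<le> outer_content B"
  unfolding outer_content_def by (intro INF_superset_mono) auto

lemma outer_content_empty [simp]: "outer_content {} = 0"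
  by (simp add: outer_content_open open_content_def zero)

text \<open>
  A function \<open>f \<prec> U \<union> V\<close> is split as \<open>g f + (1 - g) f\<close>, where \<open>g \<prec> U\<close> equals 1 on a
  neighbourhood of the part of the support of \<open>f\<close> outside \<open>V\<close>.
\<close>

lemma open_content_Un:
  assumes "open U" "open V"
  shows "open_content (U \<union> V) \<le> open_content U + open_content V"
  unfolding open_content_def[of "U \<union> V"]
proof (rule SUP_least, clarify)
  fix f assume f: "f \<prec>\<^sub>s U \<union> V"
  define K where "K = closure {x. apply_cc f x \<noteq> 0}"
  have K: "compact K" by (simp add: K_def compact_support_cc)
  have "compact (K - V)" using K assms(2) by (simp add: compact_diff)
  moreover have "K - V \<subseteq> U" using f by (auto simp: prec_below_def K_def)
  ultimately obtain g W where gW: "open W" "K - V \<subseteq> W" "W \<prec>\<^sub>f g" "g \<prec>\<^sub>s U"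
    using cc_urysohn[OF lc] assms(1) by metis
  have f01: "0 \<le> apply_cc f x" "apply_cc f x \<le> 1" for x
    using f by (auto simp: prec_below_def)
  have g01: "0 \<le> apply_cc g x" "apply_cc g x \<le> 1" for x
    using gW(3) by (auto simp: prec_above_def)
  have f0: "apply_cc f x = 0" if "x \<notin> K" for x
    using that unfolding K_def by (rule cc_zero_outside)
  have "\<exists>f1. apply_cc f1 = (\<lambda>x. apply_cc g x * apply_cc f x)"
    by (rule cc_exists[OF _ K]) (auto intro: continuous_on_mult continuous_on_cc simp: f0)
  then obtain f1 where f1: "\<And>x. apply_cc f1 x = apply_cc g x * apply_cc f x" by metis
  have "{x. apply_cc f1 x \<noteq> 0} \<subseteq> {x. apply_cc g x \<noteq> 0}" by (auto simp: f1)
  then have "closure {x. apply_cc f1 x \<noteq> 0} \<subseteq> U"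
    using gW(4) closure_mono unfolding prec_below_def by (meson order_trans)
  then have "f1 \<prec>\<^sub>s U"
    using f01 g01 by (simp add: prec_below_def f1 mult_le_one)
  have d: "apply_cc (f - f1) x = (1 - apply_cc g x) * apply_cc f x" for x
    by (simp add: minus_cc.rep_eq f1 algebra_simps)
  have "{x. apply_cc (f - f1) x \<noteq> 0} \<subseteq> K - W"
    using gW(3) f0 by (auto simp: d prec_above_def)
  moreover have "closed (K - W)" using K gW(1) by (simp add: closed_Diff compact_imp_closed)
  ultimately have "closure {x. apply_cc (f - f1) x \<noteq> 0} \<subseteq> V"
    using gW(2) closure_minimal by blast
  then have "f - f1 \<prec>\<^sub>s V"
    using f01 g01 by (simp add: prec_below_def d mult_le_one)
  have "\<Lambda> f = \<Lambda> f1 + \<Lambda> (f - f1)"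
    by (simp add: diff)
  then have "ennreal (\<Lambda> f) = ennreal (\<Lambda> f1) + ennreal (\<Lambda> (f - f1))"
    using nonneg_prec_below[OF \<open>f1 \<prec>\<^sub>s U\<close>] nonneg_prec_below[OF \<open>f - f1 \<prec>\<^sub>s V\<close>] by simp
  also have "\<dots> \<le> open_content U + open_content V"
    using open_content_upper[OF \<open>f1 \<prec>\<^sub>s U\<close>] open_content_upper[OF \<open>f - f1 \<prec>\<^sub>s V\<close>] by (rule add_mono)
  finally show "ennreal (\<Lambda> f) \<le> open_content U + open_content V" .
qed

lemma open_content_finite_UN:
  fixes V :: "nat \<Rightarrow> 'x set"
  assumes "\<And>i. open (V i)"
  shows "open_content (\<Union>i<n. V i) \<le> (\<Sum>i<n. open_content (V i))"
proof (induction n)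
  case 0
  show ?case using outer_content_empty by (simp flip: outer_content_open)
next
  case (Suc n)
  have "open_content (\<Union>i<Suc n. V i) \<le> open_content (V n) + open_content (\<Union>i<n. V i)"
    using open_content_Un[of "V n" "\<Union>i<n. V i"] assms by (auto simp: lessThan_Suc)
  also have "\<dots> \<le> (\<Sum>i<Suc n. open_content (V i))"
    using Suc by (simp add: add.commute add_mono)
  finally show ?case .
qed

text \<open>The support of a function \<open>f \<prec>\<^sub>s (\<Union>i. V i)\<close> is compact,
  so finitely many of the \<open>V i\<close> already contain it and finite subadditivity
  applies.\<close>

lemma open_content_UN:
  fixes V :: "nat \<Rightarrow> 'x set"
  assumes "\<And>i. open (V i)"
  shows "open_content (\<Union>i. V i) \<le> (\<Sum>i. open_content (V i))"
  unfolding open_content_def[of "\<Union>i. V i"]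
proof (rule SUP_least, clarify)
  fix f assume f: "f \<prec>\<^sub>s (\<Union>i. V i)"
  define K where "K = closure {x. apply_cc f x \<noteq> 0}"
  have "compact K" by (simp add: K_def compact_support_cc)
  moreover have "K \<subseteq> (\<Union>i. V i)" using f by (simp add: prec_below_def K_def)
  ultimately obtain D where D: "finite D" "K \<subseteq> (\<Union>i\<in>D. V i)"
    using compactE_image[of K UNIV V] assms by metis
  obtain n where "D \<subseteq> {..<n}"
    using finite_nat_iff_bounded D(1) by blast
  with D(2) have "K \<subseteq> (\<Union>i<n. V i)" by blast
  then have "f \<prec>\<^sub>s (\<Union>i<n. V i)"
    using f by (simp add: prec_below_def K_def)
  then have "ennreal (\<Lambda> f) \<le> (\<Sum>i<n. open_content (V i))"
    using open_content_upper open_content_finite_UN[of V n, OF assms] by (meson order_trans)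
  also have "\<dots> \<le> (\<Sum>i. open_content (V i))"
    by (intro sum_le_suminf) auto
  finally show "ennreal (\<Lambda> f) \<le> (\<Sum>i. open_content (V i))" .
qed

lemma outer_content_UN:
  fixes A :: "nat \<Rightarrow> 'x set"
  shows "outer_content (\<Union>i. A i) \<le> (\<Sum>i. outer_content (A i))"
proof (cases "\<exists>i. outer_content (A i) = \<infinity>")
  case True
  then obtain i where "outer_content (A i) = \<infinity>" by blast
  moreover have "outer_content (A i) \<le> (\<Sum>i. outer_content (A i))"
    using sum_le_suminf[of "\<lambda>i. outer_content (A i)" "{i}"] by simp
  ultimately show ?thesis by (simp add: top_unique)
next
  case False
  show ?thesis
  proof (rule ennreal_le_epsilon)
    fix e :: real assume e: "0 < e"
    \<comment> \<open>The tolerances \<open>e * (1/2) ^ Suc i\<close> add up to \<open>e\<close>.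
      Finiteness of every \<open>outer_content (A i)\<close> makes the inequality strict, which
      permits the choice of \<open>V\<close>.\<close>
    have "\<exists>V. open V \<and> A i \<subseteq> V \<and> open_content V < outer_content (A i) + ennreal (e * (1/2) ^ Suc i)" for i
    proof -
      have "outer_content (A i) < outer_content (A i) + ennreal (e * (1/2) ^ Suc i)"
        using False e ennreal_add_left_cancel_less[of "outer_content (A i)" 0] by simp
      then show ?thesis
        unfolding outer_content_def INF_less_iff by auto
    qed
    then obtain V where V: "\<And>i. open (V i)" "\<And>i. A i \<subseteq> V i"
      "\<And>i. open_content (V i) < outer_content (A i) + ennreal (e * (1/2) ^ Suc i)"
      by metis
    have "outer_content (\<Union>i. A i) \<le> open_content (\<Union>i. V i)"
      unfolding outer_content_def by (rule INF_lower) (use V in auto)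
    also have "\<dots> \<le> (\<Sum>i. open_content (V i))"
      using V by (intro open_content_UN)
    also have "\<dots> \<le> (\<Sum>i. outer_content (A i) + ennreal (e * (1/2) ^ Suc i))"
      using V(3) by (intro suminf_le) (auto intro: less_imp_le)
    also have "\<dots> = (\<Sum>i. outer_content (A i)) + (\<Sum>i. ennreal (e * (1/2) ^ Suc i))"
      by (rule suminf_add[symmetric]) auto
    also have "(\<Sum>i. ennreal (e * (1/2) ^ Suc i)) = ennreal e"
    proof (rule suminf_ennreal_eq)
      show "(\<lambda>i. e * (1/2) ^ Suc i) sums e"
        using sums_mult[OF power_half_series, of e] by simp
    qed (use e in auto)
    finally show "outer_content (\<Union>i. A i) \<le> (\<Sum>i. outer_content (A i)) + ennreal e" .
  qed
qed

section \<open>Caratheodory's condition for open sets\<close>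

lemma outer_measure_space_content: "outer_measure_space UNIV outer_content"
  by (auto simp: outer_measure_space_def positive_def increasing_def countably_subadditive_def
      outer_content_mono outer_content_UN)

lemma outer_content_split: "outer_content A \<le> outer_content (A \<inter> B) + outer_content (A - B)"
proof -
  interpret ring_of_sets UNIV "UNIV :: 'x set set"
    using ring_of_sets_Pow[of "UNIV :: 'x set"] by simp
  have "subadditive UNIV outer_content"
    using countably_subadditive_subadditive outer_measure_space_content
    by (simp add: outer_measure_space_def)
  then have "outer_content ((A \<inter> B) \<union> (A - B)) \<le> outer_content (A \<inter> B) + outer_content (A - B)"
    by (rule subadditiveD) auto
  then show ?thesis by (simp add: Int_Diff_Un)
qed

text \<open>If \<open>f\<close> is supported in \<open>U \<inter> V\<close> and \<open>g\<close> in
  \<open>U\<close> minus the support of \<open>f\<close>, then at most one of them is nonzero at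
  each point, so \<open>f + g \<prec>\<^sub>s U\<close>. As \<open>U - V\<close> need not be open,
  it is enlarged to the open set \<open>W\<close>, which depends on \<open>f\<close>; hence the
  supremum over \<open>g\<close> is taken before the one over \<open>f\<close>.\<close>

lemma open_content_split:
  assumes "open U" "open V"
  shows "open_content (U \<inter> V) + outer_content (U - V) \<le> open_content U"
proof -
  have "ennreal (\<Lambda> f) + outer_content (U - V) \<le> open_content U" if f: "f \<prec>\<^sub>s U \<inter> V" for f
  proof -
    define W where "W = U - closure {x. apply_cc f x \<noteq> 0}"
    have "open W" using assms(1) by (simp add: W_def open_Diff)
    have "U - V \<subseteq> W" using f by (auto simp: W_def prec_below_def)
    have "ennreal (\<Lambda> f) + ennreal (\<Lambda> g) \<le> open_content U" if g: "g \<prec>\<^sub>s W" for g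
    proof -
      have "{x. apply_cc (f + g) x \<noteq> 0} \<subseteq> {x. apply_cc f x \<noteq> 0} \<union> {x. apply_cc g x \<noteq> 0}"
        by (auto simp: plus_cc.rep_eq)
      then have "closure {x. apply_cc (f + g) x \<noteq> 0}
          \<subseteq> closure {x. apply_cc f x \<noteq> 0} \<union> closure {x. apply_cc g x \<noteq> 0}"
        by (simp flip: closure_Un add: closure_mono)
      moreover have "apply_cc f x = 0 \<or> apply_cc g x = 0" for x
        using g cc_zero_outside[of x f] cc_zero_outside[of x g] by (auto simp: prec_below_def W_def)
      then have "0 \<le> apply_cc (f + g) x \<and> apply_cc (f + g) x \<le> 1" for x
        using f g unfolding prec_below_def plus_cc.rep_eq by (metis add.right_neutral add_0)
      ultimately have "f + g \<prec>\<^sub>s U"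
        using f g by (auto simp: prec_below_def W_def)
      then show ?thesis
        using open_content_upper[of "f + g" U] nonneg_prec_below[OF f] nonneg_prec_below[OF g]
        by (simp add: add)
    qed
    then have "ennreal (\<Lambda> f) + open_content W \<le> open_content U"
      unfolding open_content_def[of W]
      by (subst ennreal_SUP_add_right) (auto intro!: SUP_least exI[of _ 0])
    moreover have "outer_content (U - V) \<le> open_content W"
      using outer_content_mono[OF \<open>U - V \<subseteq> W\<close>] \<open>open W\<close> by (simp add: outer_content_open)
    ultimately show ?thesis
      by (meson add_left_mono order_trans)
  qed
  then show ?thesis
    unfolding open_content_def[of "U \<inter> V"]
    by (subst ennreal_SUP_add_left[symmetric]) (auto intro!: SUP_least exI[of _ 0])
qed

text \<open>Cutting an arbitrary \<open>A\<close> reduces to cutting the open sets that contain it,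
  because \<open>outer_content A\<close> is the infimum of their contents.\<close>

lemma open_in_lambda_system:
  assumes V: "open V"
  shows "V \<in> lambda_system UNIV UNIV outer_content"
proof -
  have "outer_content (A \<inter> V) + outer_content (A - V) \<le> outer_content A" for A
    unfolding outer_content_def[of A]
  proof (rule INF_greatest, clarify)
    fix U assume U: "open U" "A \<subseteq> U"
    have "outer_content (A \<inter> V) + outer_content (A - V) \<le> outer_content (U \<inter> V) + outer_content (U - V)"
      using U(2) by (intro add_mono outer_content_mono) auto
    also have "\<dots> \<le> open_content U"
      using open_content_split[OF U(1) V] U(1) V by (simp add: outer_content_open open_Int)
    finally show "outer_content (A \<inter> V) + outer_content (A - V) \<le> open_content U" .
  qed
  moreover have "(UNIV - V) \<inter> A = A - V" for A by blast
  ultimately show ?thesis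
    using outer_content_split by (auto simp: lambda_system_def Int_commute intro: antisym)
qed

definition riesz :: "'x measure" where
  "riesz = measure_of UNIV (sets borel) outer_content"

lemma sets_riesz [measurable_cong, simp]: "sets riesz = sets borel"
  unfolding riesz_def using sigma_algebra.sets_measure_of_eq[OF sets.sigma_algebra_axioms, of borel]
  by simp

lemma space_riesz [simp]: "space riesz = UNIV"
  by (simp add: riesz_def space_measure_of_conv)

text \<open>\<open>measure_of\<close> keeps the given set function only if it is countably additive.
  By Caratheodory's theorem it is so on the lambda system, a sigma-algebra that contains the open
  sets and hence the Borel sets.\<close>

lemma emeasure_riesz:
  assumes "A \<in> sets borel"
  shows "emeasure riesz A = outer_content A"
proof (rule emeasure_measure_of[OF riesz_def])
  interpret sigma_algebra UNIV "UNIV :: 'x set set"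
    using sigma_algebra_Pow[of "UNIV :: 'x set"] by simp
  have m: "measure_space UNIV (lambda_system UNIV UNIV outer_content) outer_content"
    using outer_measure_space_content by (rule caratheodory_lemma)
  then have "sigma_algebra UNIV (lambda_system UNIV UNIV outer_content)"
    by (simp add: measure_space_def)
  then have "sigma_sets UNIV (Collect open) \<subseteq> lambda_system UNIV UNIV outer_content"
    by (rule sigma_algebra.sigma_sets_subset) (use open_in_lambda_system in blast)
  then have "sets (borel :: 'x measure) \<subseteq> lambda_system UNIV UNIV outer_content"
    by (simp add: borel_def)
  then have sub: "sets riesz \<subseteq> lambda_system UNIV UNIV outer_content" by simp
  show "positive (sets riesz) outer_content"
    by (simp add: positive_def)
  show "countably_additive (sets riesz) outer_content"
    using m sub unfolding measure_space_def countably_additive_def by blast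
qed (use assms in auto)

section \<open>Identification of the functional with the integral\<close>

text \<open>The set where \<open>g\<close> is at least 1 need not be open, so \<open>K\<close> is
  enclosed in the open set where \<open>c * g\<close> exceeds 1, with \<open>c > 1\<close>.
  Functions supported in that set and bounded by 1 lie below \<open>c * g\<close>; then
  \<open>c\<close> tends to 1 from the right.\<close>

lemma outer_content_le:
  assumes "\<And>x. 0 \<le> apply_cc g x" "\<And>x. x \<in> K \<Longrightarrow> 1 \<le> apply_cc g x"
  shows "outer_content K \<le> ennreal (\<Lambda> g)"
proof -
  have "outer_content K \<le> ennreal c * ennreal (\<Lambda> g)" if c: "1 < c" for c
  proof -
    define U where "U = {x. 1 < c * apply_cc g x}"
    have "open U"
      unfolding U_def by (intro open_Collect_less continuous_intros continuous_on_cc)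
    have "1 < c * apply_cc g x" if "x \<in> K" for x
      using c mult_left_mono[OF assms(2)[OF that], of c] by linarith
    then have "K \<subseteq> U"
      by (auto simp: U_def)
    have "ennreal (\<Lambda> f) \<le> ennreal c * ennreal (\<Lambda> g)" if f: "f \<prec>\<^sub>s U" for f
    proof -
      have "apply_cc f x \<le> c * apply_cc g x" for x
      proof (cases "x \<in> U")
        case True
        then have "1 < c * apply_cc g x" by (simp add: U_def)
        moreover have "apply_cc f x \<le> 1" using f by (simp add: prec_below_def)
        ultimately show ?thesis by linarith
      next
        case False
        then have "apply_cc f x = 0" using f cc_zero_outside by (auto simp: prec_below_def)
        then show ?thesis using c assms(1)[of x] by simp
      qed
      then have "\<Lambda> f \<le> \<Lambda> (c *\<^sub>R g)"
        by (intro mono) (simp add: less_eq_cc.rep_eq scaleR_cc.rep_eq)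
      then have "\<Lambda> f \<le> c * \<Lambda> g" by (simp add: scale)
      then show ?thesis
        using c by (simp flip: ennreal_mult' add: ennreal_leI)
    qed
    then have "open_content U \<le> ennreal c * ennreal (\<Lambda> g)"
      unfolding open_content_def by (intro SUP_least) auto
    then show ?thesis
      using outer_content_mono[OF \<open>K \<subseteq> U\<close>] \<open>open U\<close> by (simp add: outer_content_open)
  qed
  moreover have "((\<lambda>c. ennreal c * ennreal (\<Lambda> g)) \<longlongrightarrow> ennreal 1 * ennreal (\<Lambda> g)) (at_right 1)"
    by (intro tendsto_mult_ennreal tendsto_ennrealI tendsto_const tendsto_ident_at) auto
  moreover have "\<forall>\<^sub>F c in at_right (1::real). 1 < c"
    by (rule eventually_at_right_less)
  ultimately have "outer_content K \<le> ennreal 1 * ennreal (\<Lambda> g)"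
    by (intro tendsto_lowerbound[where F = "at_right (1::real)"]) (auto elim: eventually_mono)
  then show ?thesis by simp
qed

lemma outer_content_ge:
  assumes "\<And>x. 0 \<le> apply_cc g x" "\<And>x. apply_cc g x \<le> 1" "compact L"
    and "\<And>x. x \<notin> L \<Longrightarrow> apply_cc g x = 0"
  shows "ennreal (\<Lambda> g) \<le> outer_content L"
  unfolding outer_content_def
proof (rule INF_greatest, clarify)
  fix V assume "open V" "L \<subseteq> V"
  have "closure {x. apply_cc g x \<noteq> 0} \<subseteq> L"
    using assms(3,4) by (intro closure_minimal compact_imp_closed) auto
  then have "g \<prec>\<^sub>s V"
    using \<open>L \<subseteq> V\<close> assms(1,2) by (auto simp: prec_below_def)
  then show "ennreal (\<Lambda> g) \<le> open_content V"
    by (rule open_content_upper)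
qed

lemma outer_content_compact_finite:
  assumes "compact K"
  shows "outer_content K < \<infinity>"
proof -
  obtain g W where "open W" "K \<subseteq> W" "W \<prec>\<^sub>f g" "g \<prec>\<^sub>s (UNIV :: 'x set)"
    by (rule cc_urysohn[OF lc assms open_UNIV subset_UNIV])
  then have "outer_content K \<le> ennreal (\<Lambda> g)"
    by (intro outer_content_le) (auto simp: prec_above_def)
  then show ?thesis
    using le_less_trans[OF _ ennreal_less_top] by (simp add: infinity_ennreal_def)
qed

lemma emeasure_riesz_compact_finite: "compact K \<Longrightarrow> emeasure riesz K < \<infinity>"
  using outer_content_compact_finite by (simp add: emeasure_riesz borel_compact)

lemma integrable_riesz [simp]: "integrable riesz (apply_cc f)"
proof -
  obtain B where B: "\<And>x. norm (apply_cc f x) \<le> B"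
    using bounded_cc[of f] by (auto simp: bounded_iff)
  show ?thesis
  proof (rule integrableI_bounded_set)
    show "emeasure riesz (closure {x. apply_cc f x \<noteq> 0}) < \<infinity>"
      by (intro emeasure_riesz_compact_finite compact_support_cc)
  qed (use B cc_zero_outside in auto)
qed

text \<open>Functional and integral obey the same bound. With its counterpart
  \<open>measure_riesz_ge\<close> this is, besides linearity, the only information by which the two
  are compared.\<close>

lemma measure_riesz_le:
  assumes "compact K" "\<And>x. 0 \<le> apply_cc g x" "\<And>x. x \<in> K \<Longrightarrow> 1 \<le> apply_cc g x"
  shows "measure riesz K \<le> \<Lambda> g" "measure riesz K \<le> (\<integral>x. apply_cc g x \<partial>riesz)"
proof -
  have K: "K \<in> sets riesz" using assms(1) by (simp add: borel_compact)
  have "0 \<le> \<Lambda> g"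
    by (rule nonneg) (simp add: less_eq_cc.rep_eq zero_cc.rep_eq assms(2))
  then show "measure riesz K \<le> \<Lambda> g"
    using outer_content_le[OF assms(2,3)] K unfolding measure_def
    by (simp add: emeasure_riesz enn2real_leI)
  have "measure riesz K = (\<integral>x. indicator K x \<partial>riesz)"
    using K by simp
  also have "\<dots> \<le> (\<integral>x. apply_cc g x \<partial>riesz)"
    using K emeasure_riesz_compact_finite[OF assms(1)] assms(2,3)
    by (intro integral_mono integrable_riesz integrable_real_indicator) (auto split: split_indicator)
  finally show "measure riesz K \<le> (\<integral>x. apply_cc g x \<partial>riesz)" .
qed

lemma measure_riesz_ge:
  assumes "compact L" "\<And>x. 0 \<le> apply_cc g x" "\<And>x. apply_cc g x \<le> 1"
    and "\<And>x. x \<notin> L \<Longrightarrow> apply_cc g x = 0"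
  shows "\<Lambda> g \<le> measure riesz L" "(\<integral>x. apply_cc g x \<partial>riesz) \<le> measure riesz L"
proof -
  have L: "L \<in> sets riesz" using assms(1) by (simp add: borel_compact)
  have fin: "emeasure riesz L < \<infinity>" by (rule emeasure_riesz_compact_finite[OF assms(1)])
  have "ennreal (\<Lambda> g) \<le> ennreal (measure riesz L)"
    using outer_content_ge[OF assms(2,3,1,4)] L fin
    by (simp add: emeasure_riesz emeasure_eq_ennreal_measure flip: emeasure_riesz)
  then show "\<Lambda> g \<le> measure riesz L"
    by (simp add: ennreal_le_iff)
  have "(\<integral>x. apply_cc g x \<partial>riesz) \<le> (\<integral>x. indicator L x \<partial>riesz)"
    using L fin assms(2-4)
    by (intro integral_mono integrable_riesz integrable_real_indicator) (auto split: split_indicator)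
  then show "(\<integral>x. apply_cc g x \<partial>riesz) \<le> measure riesz L"
    using L by simp
qed

text \<open>
  Cutting \<open>n f\<close> into layers of height 1 squeezes both sides of the identity
  \<open>\<Lambda> f = \<integral> f\<close> between the sums of the measures of the upper level sets.
\<close>

lemma layer_bound:
  assumes f: "\<And>x. 0 \<le> apply_cc f x"
  shows "\<bar>\<Lambda> f - (\<integral>x. apply_cc f x \<partial>riesz)\<bar> * real n
    \<le> measure riesz (closure {x. apply_cc f x \<noteq> 0})"
proof -
  define S where "S = closure {x. apply_cc f x \<noteq> 0}"
  have S: "compact S" by (simp add: S_def compact_support_cc)
  have f0: "apply_cc f x = 0" if "x \<notin> S" for x
    using that unfolding S_def by (rule cc_zero_outside)
  define t where "t x = real n * apply_cc f x" for x
  have t: "continuous_on A t" "t x \<ge> 0" for A x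
    using f by (auto simp: t_def intro!: continuous_intros continuous_on_cc)
  have t0: "t x = 0" if "x \<notin> S" for x using f0[OF that] by (simp add: t_def)
  \<comment> \<open>Intersecting with \<open>S\<close> makes the level sets compact; the lowest one
    is \<open>S\<close> itself, although \<open>0 \<le> t x\<close> holds everywhere.\<close>
  define K where "K k = S \<inter> {x. real k \<le> t x}" for k
  have K: "compact (K k)" for k
    unfolding K_def using S
    by (intro compact_Int_closed closed_Collect_le continuous_on_const t)
  have K0: "K 0 = S" using t by (auto simp: K_def)
  have "\<exists>g. apply_cc g = (\<lambda>x. min (max (t x - real k) 0) 1)" for k
    by (rule cc_exists[OF _ S]) (auto simp: t0 intro!: continuous_on_min continuous_on_max continuous_on_diff continuous_on_const t)
  then obtain g where g: "\<And>k x. apply_cc (g k) x = min (max (t x - real k) 0) 1" by metis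
  obtain B where B: "\<And>x. t x \<le> B"
  proof -
    have "t x \<le> real n * norm f" for x
      using cc_abs_le_norm[of f x] by (simp add: t_def mult_left_mono)
    then show thesis using that by blast
  qed
  obtain N where N: "B \<le> real N" using real_arch_simple by blast
  have sum_g: "(\<Sum>k<N. g k) = real n *\<^sub>R f"
  proof (rule cc_eqI)
    fix x
    have "apply_cc (\<Sum>k<N. g k) x = min (t x) (real N)"
      unfolding apply_cc_sum g by (rule sum_unit_layers[OF t(2)])
    also have "\<dots> = t x" using B[of x] N by simp
    finally show "apply_cc (\<Sum>k<N. g k) x = apply_cc (real n *\<^sub>R f) x"
      by (simp add: t_def scaleR_cc.rep_eq)
  qed
  define m where "m k = measure riesz (K k)" for k
  have g01: "0 \<le> apply_cc (g k) x" "apply_cc (g k) x \<le> 1" for k x by (simp_all add: g)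
  have g1: "1 \<le> apply_cc (g k) x" if "x \<in> K (Suc k)" for k x
    using that by (auto simp: g K_def)
  have g0: "apply_cc (g k) x = 0" if "x \<notin> K k" for k x
    using that t0[of x] by (auto simp: g K_def)
  have lower: "m (Suc k) \<le> \<Lambda> (g k)" "m (Suc k) \<le> (\<integral>x. apply_cc (g k) x \<partial>riesz)" for k
    unfolding m_def using measure_riesz_le[OF K g01(1) g1] by auto
  have upper: "\<Lambda> (g k) \<le> m k" "(\<integral>x. apply_cc (g k) x \<partial>riesz) \<le> m k" for k
    unfolding m_def using measure_riesz_ge[OF K g01 g0] by auto
  have L: "\<Lambda> f * real n = (\<Sum>k<N. \<Lambda> (g k))"
    using sum_g by (metis linear_sum[OF linear] scale real_scaleR_def mult.commute)
  have "(\<integral>x. apply_cc f x \<partial>riesz) * real n = (\<integral>x. apply_cc (\<Sum>k<N. g k) x \<partial>riesz)"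
    by (simp add: sum_g scaleR_cc.rep_eq mult.commute)
  also have "\<dots> = (\<Sum>k<N. \<integral>x. apply_cc (g k) x \<partial>riesz)"
    unfolding apply_cc_sum by (rule Bochner_Integration.integral_sum) simp
  finally have I: "(\<integral>x. apply_cc f x \<partial>riesz) * real n = (\<Sum>k<N. \<integral>x. apply_cc (g k) x \<partial>riesz)" .
  \<comment> \<open>The sums for the functional and for the integral both lie between these two
    sums, whose difference is at most the measure of the support, whatever \<open>n\<close>
    is.\<close>
  have tel: "(\<Sum>k<N. m k) - (\<Sum>k<N. m (Suc k)) = m 0 - m N"
    by (simp add: sum_subtractf[symmetric] sum_lessThan_telescope')
  have "\<bar>\<Lambda> f * real n - (\<integral>x. apply_cc f x \<partial>riesz) * real n\<bar> \<le> (\<Sum>k<N. m k) - (\<Sum>k<N. m (Suc k))"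
    using sum_mono[of "{..<N}" "\<lambda>k. m (Suc k)", OF lower(1)] sum_mono[of "{..<N}" "\<lambda>k. m (Suc k)", OF lower(2)]
      sum_mono[of "{..<N}" _ m, OF upper(1)] sum_mono[of "{..<N}" _ m, OF upper(2)]
    unfolding L I by linarith
  also have "\<dots> \<le> m 0" unfolding tel by (simp add: m_def)
  finally show ?thesis
    by (simp add: m_def K0 S_def left_diff_distrib[symmetric] abs_mult)
qed

text \<open>The right-hand side of \<open>layer_bound\<close> is independent of \<open>n\<close>, so
  a nonzero difference would contradict the Archimedean property.\<close>

lemma integral_riesz_nonneg:
  assumes "\<And>x. 0 \<le> apply_cc f x"
  shows "(\<integral>x. apply_cc f x \<partial>riesz) = \<Lambda> f"
proof (rule ccontr)
  assume "\<not> ?thesis"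
  then have "0 < \<bar>\<Lambda> f - (\<integral>x. apply_cc f x \<partial>riesz)\<bar>" by simp
  from reals_Archimedean3[OF this]
  obtain n :: nat where "measure riesz (closure {x. apply_cc f x \<noteq> 0})
      < real n * \<bar>\<Lambda> f - (\<integral>x. apply_cc f x \<partial>riesz)\<bar>"
    by blast
  with layer_bound[of f n] assms show False
    by (simp add: mult.commute)
qed

theorem nn_integral_riesz:
  assumes "\<And>x. 0 \<le> apply_cc f x"
  shows "(\<integral>\<^sup>+x. ennreal (apply_cc f x) \<partial>riesz) = ennreal (\<Lambda> f)"
  using assms by (simp add: nn_integral_eq_integral integral_riesz_nonneg)

end

section \<open>The extended space\<close>

lemma Fin_le_Fin [simp]: "Fin a \<le> Fin b \<longleftrightarrow> a \<le> b"
  and le_Infty [simp]: "x \<le> Infty"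
  and Infty_le_iff [simp]: "Infty \<le> x \<longleftrightarrow> x = Infty"
  by (auto simp: less_eq_with_inf_def split: with_inf.splits)

lemma le_Fin_iff: "x \<le> Fin b \<longleftrightarrow> (\<exists>a. x = Fin a \<and> a \<le> b)"
  by (cases x) auto

lemma zero_le_Fin [simp]: "0 \<le> Fin a \<longleftrightarrow> 0 \<le> a"
  by (simp add: zero_with_inf_def)

lemma zero_le_Infty [simp]: "0 \<le> Infty"
  by (simp add: zero_with_inf_def)

lemma Fin_add [simp]: "Fin a + Fin b = Fin (a + b)"
  and Infty_add [simp]: "Infty + x = Infty" "x + Infty = Infty"
  by (auto simp: plus_with_inf_def split: with_inf.splits)

lemma Fin_sum: "(\<Sum>i\<in>I. Fin (f i)) = Fin (\<Sum>i\<in>I. f i)"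
  by (induction I rule: infinite_finite_induct) (auto simp: zero_with_inf_def)

lemma with_inf_add_increasing:
  fixes x y :: "'e::ordered_ab_group_add with_inf"
  shows "0 \<le> y \<Longrightarrow> x \<le> x + y"
  by (cases x; cases y) auto

lemma with_inf_sum_nonneg:
  fixes f :: "'i \<Rightarrow> 'e::ordered_ab_group_add with_inf"
  shows "(\<And>i. i \<in> I \<Longrightarrow> 0 \<le> f i) \<Longrightarrow> 0 \<le> (\<Sum>i\<in>I. f i)"
proof (induction I rule: infinite_finite_induct)
  case (insert i I)
  then show ?case
    using with_inf_add_increasing[of "sum f I" "f i"] by (auto intro: order_trans)
qed auto

lemma with_inf_member_le_sum:
  fixes f :: "'i \<Rightarrow> 'e::ordered_ab_group_add with_inf"
  assumes "finite I" "i \<in> I" "\<And>i. i \<in> I \<Longrightarrow> 0 \<le> f i"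
  shows "f i \<le> (\<Sum>i\<in>I. f i)"
  using assms with_inf_add_increasing[of "sum f (I - {i})" "f i"] with_inf_sum_nonneg[of "I - {i}" f]
  by (simp add: sum.remove)

lemma isLub_UNIV_unique: "isLub UNIV S s \<Longrightarrow> isLub UNIV S t \<Longrightarrow> s = (t :: 'a::order)"
  by (auto simp: isLub_UNIV_iff intro: antisym)

lemma isGlb_UNIV_unique: "isGlb UNIV S s \<Longrightarrow> isGlb UNIV S t \<Longrightarrow> s = (t :: 'a::order)"
  by (auto simp: isGlb_UNIV_iff intro: antisym)

text \<open>The only new upper bound in the extended space is \<open>Infty\<close>, which lies above
  \<open>Fin s\<close> anyway.\<close>

lemma isLub_Fin_iff: "isLub UNIV (Fin ` S) (Fin s) \<longleftrightarrow> isLub UNIV S s"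
proof -
  have "(\<forall>u. (\<forall>y\<in>Fin ` S. y \<le> u) \<longrightarrow> Fin s \<le> u) \<longleftrightarrow> (\<forall>u. (\<forall>y\<in>S. y \<le> u) \<longrightarrow> s \<le> u)"
  proof (intro iffI allI impI)
    fix u assume *: "\<forall>u. (\<forall>y\<in>S. y \<le> u) \<longrightarrow> s \<le> u" "\<forall>y\<in>Fin ` S. y \<le> u"
    then show "Fin s \<le> u" by (cases u) auto
  next
    fix u assume *: "\<forall>u. (\<forall>y\<in>Fin ` S. y \<le> u) \<longrightarrow> Fin s \<le> u" "\<forall>y\<in>S. y \<le> u"
    from *(2) have "\<forall>y\<in>Fin ` S. y \<le> Fin u" by auto
    with *(1) have "Fin s \<le> Fin u" by blast
    then show "s \<le> u" by simp
  qed
  then show ?thesis by (auto simp: isLub_UNIV_iff)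
qed

text \<open>Signs are left open, because this is applied to values \<open>x' a\<close> at elements
  \<open>a\<close> that may fail to be positive.\<close>

lemma ennreal_add_le: "ennreal (a + b) \<le> ennreal a + ennreal b"
proof (cases "0 \<le> a \<and> 0 \<le> b")
  case False
  then have "ennreal (a + b) \<le> ennreal a \<or> ennreal (a + b) \<le> ennreal b"
    by (auto intro: ennreal_leI)
  then show ?thesis
    by (meson add_increasing add_increasing2 order_trans zero_le order_refl)
qed simp

section \<open>Positive vector measures\<close>

lemma positive_measure_nonneg: "positive_measure M \<mu> \<Longrightarrow> A \<in> sets M \<Longrightarrow> 0 \<le> \<mu> A"
  unfolding positive_measure_def by (auto simp: PiE_iff)

lemma positive_measure_empty: "positive_measure M \<mu> \<Longrightarrow> \<mu> {} = 0"
  by (simp add: positive_measure_def)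

lemma positive_measure_lub:
  assumes "positive_measure M \<mu>" "\<And>n. \<Delta> n \<in> sets M" "disjoint_family \<Delta>"
  shows "isLub UNIV (range (\<lambda>N::nat. \<Sum>n\<le>N. \<mu> (\<Delta> n))) (\<mu> (\<Union>n. \<Delta> n))"
  using assms unfolding positive_measure_def by blast

text \<open>The disjoint sequence \<open>A\<close>, \<open>B - A\<close>, empty, empty, ... has
  union \<open>B\<close>, and its partial sum with last index 0 is the single term
  \<open>\<mu> A\<close>.\<close>

lemma positive_measure_mono:
  assumes \<mu>: "positive_measure M \<mu>" and "A \<in> sets M" "B \<in> sets M" "A \<subseteq> B"
  shows "\<mu> A \<le> \<mu> B"
proof -
  define \<Delta> where "\<Delta> = binaryset A (B - A)"
  have "disjoint_family \<Delta>" "(\<Union>n. \<Delta> n) = B"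
    using assms(4) by (auto simp: \<Delta>_def disjoint_family_on_def binaryset_def UN_binaryset_eq split: if_splits)
  moreover have "\<Delta> n \<in> sets M" for n using assms by (auto simp: \<Delta>_def binaryset_def)
  ultimately have "(\<Sum>n\<le>(0::nat). \<mu> (\<Delta> n)) \<le> \<mu> B"
    using positive_measure_lub[OF \<mu>, of \<Delta>] unfolding isLub_UNIV_iff by (metis rangeI)
  then show ?thesis by (simp add: \<Delta>_def binaryset_def)
qed

lemma SUP_partial_sums: "(SUP N. \<Sum>n\<le>N. f n) = (\<Sum>n. f n)" for f :: "nat \<Rightarrow> ennreal"
proof (rule LIMSEQ_unique[OF LIMSEQ_SUP])
  show "(\<lambda>N. \<Sum>n\<le>N. f n) \<longlonglongrightarrow> (\<Sum>n. f n)" by (rule summable_LIMSEQ') simp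
qed (auto simp: incseq_def intro!: sum_mono2)

text \<open>\<open>nn_order_integral\<close> is a definite description over all approximating
  sequences, so its value is determined only if there is one. The approximants \<open>F i\<close>
  are finite everywhere, so \<open>enn2real\<close> loses nothing.\<close>

lemma elementary_approx_exists:
  assumes "h \<in> borel_measurable N"
  shows "\<exists>\<phi>. elementary_approx N \<phi> (\<lambda>x. ennreal (h x))"
proof -
  obtain F where F: "\<And>i. simple_function N (F i)" "incseq F" "\<And>i x. F i x < top"
      "\<And>x. (SUP i. F i x) = ennreal (h x)"
    using borel_measurable_implies_simple_function_sequence'[of "\<lambda>x. ennreal (h x)" N] assms by auto
  have inc: "incseq (\<lambda>i. F i x)" for x using F(2) by (auto simp: incseq_def le_fun_def)
  have "elementary_approx N (\<lambda>i x. enn2real (F i x)) (\<lambda>x. ennreal (h x))"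
    unfolding elementary_approx_def elementary_def
  proof (intro conjI allI ballI)
    show "simple_function N (\<lambda>x. enn2real (F i x))" for i
      using simple_function_compose[OF F(1), of enn2real] by (simp add: o_def)
    show "incseq (\<lambda>n. enn2real (F n x))" for x
      using inc[of x] F(3) by (auto simp: incseq_def intro!: enn2real_mono)
    show "(\<lambda>n. ennreal (enn2real (F n x))) \<longlonglongrightarrow> ennreal (h x)" for x
      using LIMSEQ_SUP[OF inc[of x]] F(3,4) by simp
  qed simp
  then show ?thesis by blast
qed

lemma isLub_uminus_iff: "isLub UNIV (uminus ` S) (- s) \<longleftrightarrow> isGlb UNIV S s" for s :: "'e::ordered_ab_group_add"
proof -
  have "(\<forall>u. (\<forall>y\<in>S. - y \<le> u) \<longrightarrow> - s \<le> u) \<longleftrightarrow> (\<forall>u. (\<forall>y\<in>S. u \<le> y) \<longrightarrow> u \<le> s)"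
    by (metis minus_le_iff minus_minus neg_le_iff_le)
  then show ?thesis by (simp add: isLub_UNIV_iff isGlb_UNIV_iff)
qed

section \<open>Ordered spaces with an order continuous norm\<close>

locale order_continuous_normed_space =
  fixes E :: "'e::{ordered_real_vector,real_normed_vector} itself"
  assumes monotone_complete: "monotone_complete TYPE('e)"
    and order_continuous: "norm_order_continuous TYPE('e)"
    and cone: "\<And>x :: 'e. (\<And>x' :: 'e \<Rightarrow> real. bounded_linear x' \<Longrightarrow> positive_operator x' \<Longrightarrow>
           \<sigma>_order_continuous x' \<Longrightarrow> 0 \<le> x' x) \<Longrightarrow> 0 \<le> x"
begin

definition dual :: "('e \<Rightarrow> real) set" where
  "dual = {x'. bounded_linear x' \<and> positive_operator x' \<and> \<sigma>_order_continuous x'}"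

lemma dual_bounded_linear: "x' \<in> dual \<Longrightarrow> bounded_linear x'"
  by (simp add: dual_def)

lemma dual_linear: "x' \<in> dual \<Longrightarrow> linear x'"
  by (simp add: dual_def positive_operator_def)

lemmas dual_diff = linear_diff[OF dual_linear]
  and dual_scale = linear_scale[OF dual_linear] and dual_zero = linear_0[OF dual_linear]
  and dual_sum = linear_sum[OF dual_linear]

lemma dual_nonneg: "x' \<in> dual \<Longrightarrow> 0 \<le> x \<Longrightarrow> 0 \<le> x' x"
  by (simp add: dual_def positive_operator_def)

lemma dual_mono: "x' \<in> dual \<Longrightarrow> x \<le> y \<Longrightarrow> x' x \<le> x' y"
  using dual_nonneg[of x' "y - x"] by (simp add: dual_diff)

lemma le_dualI: "(\<And>x'. x' \<in> dual \<Longrightarrow> x' x \<le> x' y) \<Longrightarrow> x \<le> y"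
  using cone[of "y - x"] dual_diff[of _ y x] unfolding dual_def by (metis (mono_tags) diff_ge_0_iff_ge mem_Collect_eq)

lemma eq_dualI: "(\<And>x'. x' \<in> dual \<Longrightarrow> x' x = x' y) \<Longrightarrow> x = y"
  by (metis antisym le_dualI order_refl)

text \<open>From \<open>0 \<le> y\<close> follows \<open>0 \<le> x' y\<close>, so truncation at 0
  changes nothing on the larger side; a negative \<open>x' x\<close> does no harm on the smaller
  one.\<close>

lemma le_dual_ennrealI:
  assumes "0 \<le> y" "\<And>x'. x' \<in> dual \<Longrightarrow> ennreal (x' x) \<le> ennreal (x' y)"
  shows "x \<le> y"
proof (rule le_dualI)
  fix x' assume "x' \<in> dual"
  then show "x' x \<le> x' y"
    using assms(2)[of x'] dual_nonneg[of x' y] assms(1) by simp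
qed

lemma eq_dual_ennrealI:
  assumes "0 \<le> x" "0 \<le> y" "\<And>x'. x' \<in> dual \<Longrightarrow> ennreal (x' x) = ennreal (x' y)"
  shows "x = y"
proof (rule eq_dualI)
  fix x' assume x': "x' \<in> dual"
  show "x' x = x' y"
    using assms(3)[OF x'] dual_nonneg[OF x' assms(1)] dual_nonneg[OF x' assms(2)] by simp
qed

section \<open>Directed sets, their suprema and infima\<close>

text \<open>Such a set is a net indexed by itself, the form in which monotone completeness and order
  continuity of the norm are applied.\<close>

definition upward :: "'e set \<Rightarrow> bool" where
  "upward S \<longleftrightarrow> S \<noteq> {} \<and> (\<forall>a\<in>S. \<forall>b\<in>S. \<exists>c\<in>S. a \<le> c \<and> b \<le> c)"

lemma upward_incseq: "incseq x \<Longrightarrow> upward (range x)"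
  unfolding upward_def by auto (metis incseqD max.cobounded1 max.cobounded2)

lemma upward_directed_index: "upward S \<Longrightarrow> directed_index S (\<le>)"
  by (auto simp: upward_def directed_index_def reflp_on_def transp_on_def)

lemma upward_sup_exists:
  assumes "upward S" "bdd_above S"
  shows "\<exists>s. isLub UNIV S s"
  using monotone_complete_net[OF monotone_complete, of S "(\<le>)" "\<lambda>x. x"] assms upward_directed_index
  by (auto simp: increasing_net_def monotone_on_def)

lemma upward_sup_norm:
  assumes "upward S" "isLub UNIV S s" "0 < \<epsilon>"
  shows "\<exists>a\<in>S. \<forall>b\<in>S. a \<le> b \<longrightarrow> norm (s - b) < \<epsilon>"
proof (rule norm_order_continuous_net[OF order_continuous _ _ assms(3), where x = "\<lambda>b. s - b"])
  show "decreasing_net S (\<le>) (\<lambda>b. s - b)"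
    using upward_directed_index[OF assms(1)] by (auto simp: decreasing_net_def monotone_on_def)
  have "u \<le> 0" if "\<forall>b\<in>S. u \<le> s - b" for u
  proof -
    have "s \<le> s - u"
      using that assms(2) unfolding isLub_UNIV_iff by (metis add.commute le_diff_eq)
    then show ?thesis by simp
  qed
  then show "isGlb UNIV ((\<lambda>b. s - b) ` S) 0"
    using assms(2) by (auto simp: isLub_UNIV_iff isGlb_UNIV_iff)
qed

text \<open>Some \<open>a \<in> S\<close> is norm close to \<open>s\<close>, and \<open>x'\<close>
  is norm bounded by \<open>C\<close>, so \<open>x' a\<close> is close to \<open>x' s\<close>; the
  quotient \<open>e / C\<close> absorbs the bound. Every directed set is covered, as the families
  that define contents may be uncountable.\<close>

lemma dual_sup:
  assumes x': "x' \<in> dual" and S: "upward S" "isLub UNIV S s"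
  shows "ennreal (x' s) = (SUP b\<in>S. ennreal (x' b))"
proof (rule antisym)
  show "(SUP b\<in>S. ennreal (x' b)) \<le> ennreal (x' s)"
    using S(2) dual_mono[OF x'] by (intro SUP_least ennreal_leI) (auto simp: isLub_UNIV_iff)
  obtain C where C: "0 < C" "\<And>x. norm (x' x) \<le> norm x * C"
    using bounded_linear.pos_bounded[OF dual_bounded_linear[OF x']] by auto
  show "ennreal (x' s) \<le> (SUP b\<in>S. ennreal (x' b))"
  proof (rule ennreal_le_epsilon)
    fix e :: real assume "0 < e"
    then obtain a where a: "a \<in> S" "norm (s - a) < e / C"
      using upward_sup_norm[OF S, of "e / C"] C(1) by auto
    have "x' s - x' a \<le> norm (s - a) * C"
      using C(2)[of "s - a"] by (simp add: dual_diff[OF x'])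
    also have "\<dots> \<le> e" using a(2) C(1) by (simp add: field_simps)
    finally have "ennreal (x' s) \<le> ennreal (x' a + e)" by (intro ennreal_leI) simp
    also have "\<dots> \<le> ennreal (x' a) + ennreal e" by (rule ennreal_add_le)
    also have "\<dots> \<le> (SUP b\<in>S. ennreal (x' b)) + ennreal e"
      using a(1) by (intro add_right_mono SUP_upper)
    finally show "ennreal (x' s) \<le> (SUP b\<in>S. ennreal (x' b)) + ennreal e" .
  qed
qed

definition downward :: "'e set \<Rightarrow> bool" where
  "downward S \<longleftrightarrow> S \<noteq> {} \<and> (\<forall>a\<in>S. \<forall>b\<in>S. \<exists>c\<in>S. c \<le> a \<and> c \<le> b)"

lemma downward_uminus: "downward S \<Longrightarrow> upward (uminus ` S)"
  by (auto simp: downward_def upward_def)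

lemma downward_inf_exists:
  assumes "downward S" "bdd_below S"
  shows "\<exists>s. isGlb UNIV S s"
proof -
  obtain l where "\<And>y. y \<in> S \<Longrightarrow> l \<le> y" using assms(2) by (auto simp: bdd_below_def)
  then have "bdd_above (uminus ` S)" by (intro bdd_aboveI[of _ "- l"]) auto
  then obtain s where "isLub UNIV (uminus ` S) s"
    using upward_sup_exists[OF downward_uminus[OF assms(1)]] by blast
  then have "isGlb UNIV S (- s)" by (simp flip: isLub_uminus_iff)
  then show ?thesis by blast
qed

lemma downward_inf_norm:
  assumes "downward S" "isGlb UNIV S s" "0 < \<epsilon>"
  shows "\<exists>a\<in>S. norm (a - s) < \<epsilon>"
  using upward_sup_norm[OF downward_uminus[OF assms(1)], of "- s" \<epsilon>] assms(2,3)
  by (auto simp: isLub_uminus_iff norm_minus_commute)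

lemma dual_inf:
  assumes x': "x' \<in> dual" and S: "downward S" "isGlb UNIV S s"
  shows "ennreal (x' s) = (INF b\<in>S. ennreal (x' b))"
proof (rule antisym)
  show "ennreal (x' s) \<le> (INF b\<in>S. ennreal (x' b))"
    using S(2) dual_mono[OF x'] by (intro INF_greatest ennreal_leI) (auto simp: isGlb_UNIV_iff)
  obtain C where C: "0 < C" "\<And>x. norm (x' x) \<le> norm x * C"
    using bounded_linear.pos_bounded[OF dual_bounded_linear[OF x']] by auto
  show "(INF b\<in>S. ennreal (x' b)) \<le> ennreal (x' s)"
  proof (rule ennreal_le_epsilon)
    fix e :: real assume "0 < e"
    then obtain a where a: "a \<in> S" "norm (a - s) < e / C"
      using downward_inf_norm[OF S, of "e / C"] C(1) by auto
    have "x' a - x' s \<le> norm (a - s) * C"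
      using C(2)[of "a - s"] by (simp add: dual_diff[OF x'])
    also have "\<dots> \<le> e" using a(2) C(1) by (simp add: field_simps)
    finally have le: "ennreal (x' a) \<le> ennreal (x' s + e)" by (intro ennreal_leI) simp
    have "(INF b\<in>S. ennreal (x' b)) \<le> ennreal (x' a)"
      using a(1) by (intro INF_lower)
    also note le
    also have "ennreal (x' s + e) \<le> ennreal (x' s) + ennreal e" by (rule ennreal_add_le)
    finally show "(INF b\<in>S. ennreal (x' b)) \<le> ennreal (x' s) + ennreal e" .
  qed
qed

section \<open>Reduction of the order integral to scalar integrals\<close>

text \<open>This is \<open>x'\<close> composed with \<open>\<mu>\<close>, restricted to
  \<open>A\<close>. The restriction keeps \<open>fin_part\<close> away from \<open>Infty\<close>,
  where it is unspecified; it costs nothing for functions that vanish off a set of finite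
  measure.\<close>

definition scalar_measure :: "'x measure \<Rightarrow> ('x set \<Rightarrow> 'e with_inf) \<Rightarrow> 'x set \<Rightarrow> ('e \<Rightarrow> real) \<Rightarrow> 'x measure" where
  "scalar_measure M \<mu> A x' = measure_of (space M) (sets M) (\<lambda>B. ennreal (x' (fin_part (\<mu> (B \<inter> A)))))"

lemma sets_scalar_measure [measurable_cong, simp]: "sets (scalar_measure M \<mu> A x') = sets M"
  and space_scalar_measure [simp]: "space (scalar_measure M \<mu> A x') = space M"
  by (simp_all add: scalar_measure_def)

context
  fixes M :: "'x measure" and \<mu> :: "'x set \<Rightarrow> 'e with_inf" and A :: "'x set"
  assumes \<mu>: "positive_measure M \<mu>" and A: "A \<in> sets M" "is_finite (\<mu> A)"
begin

lemma Fin_part_subset: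
  assumes "B \<in> sets M" "B \<subseteq> A"
  shows "Fin (fin_part (\<mu> B)) = \<mu> B" "0 \<le> fin_part (\<mu> B)" "fin_part (\<mu> B) \<le> fin_part (\<mu> A)"
proof -
  have "\<mu> B \<le> \<mu> A" using positive_measure_mono[OF \<mu> assms(1) A(1) assms(2)] .
  moreover have "0 \<le> \<mu> B" by (rule positive_measure_nonneg[OF \<mu> assms(1)])
  ultimately show "Fin (fin_part (\<mu> B)) = \<mu> B" "0 \<le> fin_part (\<mu> B)" "fin_part (\<mu> B) \<le> fin_part (\<mu> A)"
    using A(2) by (cases "\<mu> B"; cases "\<mu> A"; simp)+
qed

text \<open>The partial sums increase in the ordered space, so \<open>dual_sup\<close> turns their
  order supremum into a supremum of numbers, which is countable additivity of the scalar set
  function.\<close>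

lemma emeasure_scalar_measure:
  assumes x': "x' \<in> dual" and B: "B \<in> sets M"
  shows "emeasure (scalar_measure M \<mu> A x') B = ennreal (x' (fin_part (\<mu> (B \<inter> A))))"
proof (rule emeasure_measure_of[OF scalar_measure_def])
  let ?v = "\<lambda>B. fin_part (\<mu> (B \<inter> A))"
  show "positive (sets (scalar_measure M \<mu> A x')) (\<lambda>B. ennreal (x' (?v B)))"
    by (simp add: positive_def positive_measure_empty[OF \<mu>] zero_with_inf_def dual_zero[OF x'])
  show "countably_additive (sets (scalar_measure M \<mu> A x')) (\<lambda>B. ennreal (x' (?v B)))"
  proof (rule countably_additiveI)
    fix \<Delta> :: "nat \<Rightarrow> 'x set"
    assume "range \<Delta> \<subseteq> sets (scalar_measure M \<mu> A x')" "disjoint_family \<Delta>"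
    then have \<Delta>: "\<And>n. \<Delta> n \<in> sets M" "disjoint_family (\<lambda>n. \<Delta> n \<inter> A)"
      by (auto simp: disjoint_family_on_def)
    have [simp]: "0 \<le> ?v B" "Fin (?v B) = \<mu> (B \<inter> A)" if "B \<in> sets M" for B
      using Fin_part_subset[of "B \<inter> A"] that A(1) by auto
    have "isLub UNIV (range (\<lambda>N. \<Sum>n\<le>N. \<mu> (\<Delta> n \<inter> A))) (\<mu> (\<Union>n. \<Delta> n \<inter> A))"
      using \<Delta> A(1) by (intro positive_measure_lub[OF \<mu>]) auto
    also have "(\<lambda>N. \<Sum>n\<le>N. \<mu> (\<Delta> n \<inter> A)) = (\<lambda>N. Fin (\<Sum>n\<le>N. ?v (\<Delta> n)))"
      using \<Delta>(1) by (simp flip: Fin_sum)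
    also have "(\<Union>n. \<Delta> n \<inter> A) = (\<Union>n. \<Delta> n) \<inter> A" by blast
    also have "\<mu> ((\<Union>n. \<Delta> n) \<inter> A) = Fin (?v (\<Union>n. \<Delta> n))"
      using Fin_part_subset(1)[of "(\<Union>n. \<Delta> n) \<inter> A"] \<Delta>(1) A(1) by auto
    finally have lub: "isLub UNIV (range (\<lambda>N. \<Sum>n\<le>N. ?v (\<Delta> n))) (?v (\<Union>n. \<Delta> n))"
      by (subst isLub_Fin_iff[symmetric]) (simp add: image_image)
    have "incseq (\<lambda>N. \<Sum>n\<le>N. ?v (\<Delta> n))"
      using \<Delta>(1) by (auto simp: incseq_def intro!: sum_mono2)
    then have "ennreal (x' (?v (\<Union>n. \<Delta> n))) = (SUP b\<in>range (\<lambda>N. \<Sum>n\<le>N. ?v (\<Delta> n)). ennreal (x' b))"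
      by (intro dual_sup[OF x' _ lub] upward_incseq)
    also have "\<dots> = (SUP N. \<Sum>n\<le>N. ennreal (x' (?v (\<Delta> n))))"
      using \<Delta>(1) dual_nonneg[OF x'] by (simp add: image_image dual_sum[OF x'] sum_ennreal)
    also have "\<dots> = (\<Sum>n. ennreal (x' (?v (\<Delta> n))))" by (rule SUP_partial_sums)
    finally show "(\<Sum>n. ennreal (x' (?v (\<Delta> n)))) = ennreal (x' (?v (\<Union>n. \<Delta> n)))" ..
  qed
qed (use B sets.space_closed in auto)

lemma elementary_integral_finite:
  assumes \<phi>: "elementary M \<phi>" and off: "\<And>x. x \<in> space M \<Longrightarrow> x \<notin> A \<Longrightarrow> \<phi> x = 0"
  obtains v where "elementary_integral M \<mu> \<phi> = Fin v" "0 \<le> v"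
    "\<And>x'. x' \<in> dual \<Longrightarrow> ennreal (x' v) = (\<integral>\<^sup>+x. ennreal (\<phi> x) \<partial>scalar_measure M \<mu> A x')"
proof
  let ?B = "\<lambda>r. \<phi> -` {r} \<inter> space M"
  let ?v = "\<Sum>r\<in>\<phi> ` space M. r *\<^sub>R fin_part (\<mu> (?B r \<inter> A))"
  have s: "simple_function M \<phi>" and nn: "\<And>r. r \<in> \<phi> ` space M \<Longrightarrow> 0 \<le> r"
    using \<phi> by (auto simp: elementary_def)
  have B: "?B r \<in> sets M" for r by (rule simple_functionD(2)[OF s])
  \<comment> \<open>The level set of the value 0 may have measure \<open>Infty\<close>; the
    convention that 0 times infinity is 0 makes both sides vanish. All other level sets lie in
    \<open>A\<close>.\<close>
  have "scale_inf r (\<mu> (?B r)) = Fin (r *\<^sub>R fin_part (\<mu> (?B r \<inter> A)))" for r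
  proof (cases "r = 0")
    case True
    then show ?thesis by (simp add: scale_inf_def zero_with_inf_def split: with_inf.split)
  next
    case False
    then have "?B r \<subseteq> A" using off by blast
    then have "\<mu> (?B r) = Fin (fin_part (\<mu> (?B r \<inter> A)))"
      using Fin_part_subset(1)[OF B] by (simp add: Int_absorb2)
    then show ?thesis by (metis scale_inf_def with_inf.case(1))
  qed
  then show "elementary_integral M \<mu> \<phi> = Fin ?v"
    unfolding elementary_integral_def by (simp add: Fin_sum)
  have pos: "0 \<le> fin_part (\<mu> (?B r \<inter> A))" for r
    using Fin_part_subset(2)[of "?B r \<inter> A"] B A(1) by blast
  then show "0 \<le> ?v" using nn by (intro sum_nonneg scaleR_nonneg_nonneg)
  fix x' assume x': "x' \<in> dual"
  let ?N = "scalar_measure M \<mu> A x'"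
  have "(\<integral>\<^sup>+x. ennreal (\<phi> x) \<partial>?N) = (\<integral>\<^sup>+x. (\<Sum>r\<in>\<phi> ` space M. ennreal r * indicator (?B r) x) \<partial>?N)"
  proof (rule nn_integral_cong)
    fix x assume "x \<in> space ?N"
    then have x: "\<phi> x \<in> \<phi> ` space M" "x \<in> space M" by auto
    have "(\<Sum>r\<in>\<phi> ` space M. ennreal r * indicator (?B r) x)
        = (\<Sum>r\<in>\<phi> ` space M. if r = \<phi> x then ennreal r else 0)"
      using x(2) by (intro sum.cong) (auto split: split_indicator)
    then show "ennreal (\<phi> x) = (\<Sum>r\<in>\<phi> ` space M. ennreal r * indicator (?B r) x)"
      using x(1) simple_functionD(1)[OF s] by simp
  qed
  also have "\<dots> = (\<Sum>r\<in>\<phi> ` space M. ennreal r * emeasure ?N (?B r))"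
    using B by (subst nn_integral_sum) (auto simp: nn_integral_cmult_indicator)
  also have "\<dots> = (\<Sum>r\<in>\<phi> ` space M. ennreal (r * x' (fin_part (\<mu> (?B r \<inter> A)))))"
    using nn by (intro sum.cong) (auto simp: emeasure_scalar_measure[OF x' B] ennreal_mult')
  also have "\<dots> = ennreal (x' ?v)"
    using nn pos dual_nonneg[OF x']
    by (subst sum_ennreal) (auto simp: dual_sum[OF x'] dual_scale[OF x'] intro!: mult_nonneg_nonneg)
  finally show "ennreal (x' ?v) = (\<integral>\<^sup>+x. ennreal (\<phi> x) \<partial>?N)" ..
qed

text \<open>The elementary integrals increase and stay below a multiple of the measure of
  \<open>A\<close>; both inequalities are checked on scalar integrals. Hence a finite supremum
  exists, and scalar monotone convergence computes its image under \<open>x'\<close>.\<close>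

lemma elementary_approx_lub:
  assumes h: "\<And>x. x \<in> space M \<Longrightarrow> 0 \<le> h x \<and> h x \<le> C" "\<And>x. x \<in> space M \<Longrightarrow> x \<notin> A \<Longrightarrow> h x = 0"
    and \<phi>: "elementary_approx M \<phi> (\<lambda>x. ennreal (h x))"
  obtains s where "isLub UNIV (range (\<lambda>n. elementary_integral M \<mu> (\<phi> n))) (Fin s)" "0 \<le> s"
    "\<And>x'. x' \<in> dual \<Longrightarrow> ennreal (x' s) = (\<integral>\<^sup>+x. ennreal (h x) \<partial>scalar_measure M \<mu> A x')"
proof -
  have el: "elementary M (\<phi> n)" and inc: "x \<in> space M \<Longrightarrow> incseq (\<lambda>n. \<phi> n x)"
    and lim: "x \<in> space M \<Longrightarrow> (\<lambda>n. ennreal (\<phi> n x)) \<longlonglongrightarrow> ennreal (h x)" for n x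
    using \<phi> by (auto simp: elementary_approx_def)
  have nn: "0 \<le> \<phi> n x" if "x \<in> space M" for n x using el that by (auto simp: elementary_def)
  have incE: "incseq (\<lambda>n. ennreal (\<phi> n x))" if "x \<in> space M" for x
    using inc[OF that] by (auto simp: incseq_def intro!: ennreal_leI)
  have le: "\<phi> n x \<le> h x" if "x \<in> space M" for n x
    using incseq_le[OF incE[OF that] lim[OF that], of n] h(1)[OF that] by (simp add: ennreal_le_iff)
  have off: "\<phi> n x = 0" if "x \<in> space M" "x \<notin> A" for n x
    using nn[OF that(1), of n] le[OF that(1), of n] h(2)[OF that] by simp
  have "\<exists>v. elementary_integral M \<mu> (\<phi> n) = Fin v \<and> 0 \<le> v \<and>
      (\<forall>x'\<in>dual. ennreal (x' v) = (\<integral>\<^sup>+x. ennreal (\<phi> n x) \<partial>scalar_measure M \<mu> A x'))" for n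
    using elementary_integral_finite[OF el off] by metis
  then obtain v where v: "\<And>n. elementary_integral M \<mu> (\<phi> n) = Fin (v n)" "\<And>n. 0 \<le> v n"
    "\<And>n x'. x' \<in> dual \<Longrightarrow> ennreal (x' (v n)) = (\<integral>\<^sup>+x. ennreal (\<phi> n x) \<partial>scalar_measure M \<mu> A x')"
    by metis
  have "incseq v"
  proof (rule incseq_SucI, rule le_dual_ennrealI[OF v(2)])
    fix n x' assume "x' \<in> dual"
    then show "ennreal (x' (v n)) \<le> ennreal (x' (v (Suc n)))"
      unfolding v(3)[OF \<open>x' \<in> dual\<close>] using incE by (intro nn_integral_mono) (auto simp: incseq_Suc_iff)
  qed
  \<comment> \<open>On an empty space \<open>C\<close> may be negative; \<open>max C 0\<close> keeps
    the bound in the cone.\<close>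
  have bound: "v n \<le> max C 0 *\<^sub>R fin_part (\<mu> A)" for n
  proof (rule le_dual_ennrealI)
    show "0 \<le> max C 0 *\<^sub>R fin_part (\<mu> A)"
      using Fin_part_subset(2)[OF A(1)] by (intro scaleR_nonneg_nonneg) auto
    fix x' assume x': "x' \<in> dual"
    have "ennreal (x' (v n)) \<le> (\<integral>\<^sup>+x. ennreal (max C 0) * indicator A x \<partial>scalar_measure M \<mu> A x')"
      unfolding v(3)[OF x']
    proof (rule nn_integral_mono)
      fix x assume "x \<in> space (scalar_measure M \<mu> A x')"
      then have x: "x \<in> space M" by simp
      show "ennreal (\<phi> n x) \<le> ennreal (max C 0) * indicator A x"
        using le[OF x, of n] h(1)[OF x] off[OF x, of n]
        by (cases "x \<in> A") (auto intro!: ennreal_leI)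
    qed
    also have "\<dots> = ennreal (max C 0) * ennreal (x' (fin_part (\<mu> A)))"
      using A(1) by (simp add: nn_integral_cmult_indicator emeasure_scalar_measure[OF x' A(1)])
    also have "\<dots> = ennreal (x' (max C 0 *\<^sub>R fin_part (\<mu> A)))"
      by (simp add: dual_scale[OF x'] ennreal_mult')
    finally show "ennreal (x' (v n)) \<le> ennreal (x' (max C 0 *\<^sub>R fin_part (\<mu> A)))" .
  qed
  then have "bdd_above (range v)" by (intro bdd_aboveI) auto
  then obtain s where s: "isLub UNIV (range v) s"
    using upward_sup_exists upward_incseq[OF \<open>incseq v\<close>] by blast
  show thesis
  proof (rule that)
    have "range (\<lambda>n. elementary_integral M \<mu> (\<phi> n)) = Fin ` range v" by (auto simp: v(1))
    then show "isLub UNIV (range (\<lambda>n. elementary_integral M \<mu> (\<phi> n))) (Fin s)"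
      using s by (simp add: isLub_Fin_iff)
    have "v 0 \<le> s" using s by (simp add: isLub_UNIV_iff)
    then show "0 \<le> s" using v(2)[of 0] by simp
    fix x' assume x': "x' \<in> dual"
    let ?N = "scalar_measure M \<mu> A x'"
    have "ennreal (x' s) = (SUP n. ennreal (x' (v n)))"
      using dual_sup[OF x' upward_incseq[OF \<open>incseq v\<close>] s] by (simp add: image_image)
    also have "\<dots> = (SUP n. \<integral>\<^sup>+x. ennreal (\<phi> n x) \<partial>?N)" by (simp add: v(3)[OF x'])
    also have "\<dots> = (\<integral>\<^sup>+x. (SUP n. ennreal (\<phi> n x)) \<partial>?N)"
    proof (rule nn_integral_monotone_convergence_SUP_AE[symmetric])
      show "AE x in ?N. ennreal (\<phi> n x) \<le> ennreal (\<phi> (Suc n) x)" for n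
        using incE by (intro AE_I2) (auto simp: incseq_Suc_iff)
      have "\<phi> n \<in> borel_measurable M" for n
        using el by (auto simp: elementary_def intro: borel_measurable_simple_function)
      then show "(\<lambda>x. ennreal (\<phi> n x)) \<in> borel_measurable ?N" for n by measurable
    qed
    also have "\<dots> = (\<integral>\<^sup>+x. ennreal (h x) \<partial>?N)"
      using LIMSEQ_unique[OF LIMSEQ_SUP[OF incE] lim] by (intro nn_integral_cong) simp
    finally show "ennreal (x' s) = (\<integral>\<^sup>+x. ennreal (h x) \<partial>?N)" .
  qed
qed

text \<open>The image of the supremum under each \<open>x'\<close> is a scalar integral of
  \<open>h\<close>, in which the approximating sequence no longer occurs. As the functionals
  separate points, all sequences give the same supremum and the definite description has exactly one
  candidate.\<close>

lemma nn_order_integral_finite: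
  assumes h: "h \<in> borel_measurable M" "\<And>x. x \<in> space M \<Longrightarrow> 0 \<le> h x \<and> h x \<le> C"
    "\<And>x. x \<in> space M \<Longrightarrow> x \<notin> A \<Longrightarrow> h x = 0"
  obtains s where "nn_order_integral M \<mu> (\<lambda>x. ennreal (h x)) = Fin s" "0 \<le> s"
    "\<And>x'. x' \<in> dual \<Longrightarrow> ennreal (x' s) = (\<integral>\<^sup>+x. ennreal (h x) \<partial>scalar_measure M \<mu> A x')"
proof -
  obtain \<phi> where \<phi>: "elementary_approx M \<phi> (\<lambda>x. ennreal (h x))"
    using elementary_approx_exists[OF h(1)] by blast
  obtain s where s: "isLub UNIV (range (\<lambda>n. elementary_integral M \<mu> (\<phi> n))) (Fin s)" "0 \<le> s"
    "\<And>x'. x' \<in> dual \<Longrightarrow> ennreal (x' s) = (\<integral>\<^sup>+x. ennreal (h x) \<partial>scalar_measure M \<mu> A x')"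
    using elementary_approx_lub[OF h(2,3) \<phi>] by metis
  have "isLub UNIV (range (\<lambda>n. elementary_integral M \<mu> (\<psi> n))) (Fin s)"
    if \<psi>: "elementary_approx M \<psi> (\<lambda>x. ennreal (h x))" for \<psi>
  proof -
    obtain t where t: "isLub UNIV (range (\<lambda>n. elementary_integral M \<mu> (\<psi> n))) (Fin t)" "0 \<le> t"
      "\<And>x'. x' \<in> dual \<Longrightarrow> ennreal (x' t) = (\<integral>\<^sup>+x. ennreal (h x) \<partial>scalar_measure M \<mu> A x')"
      using elementary_approx_lub[OF h(2,3) \<psi>] by metis
    have "s = t"
      by (rule eq_dual_ennrealI[OF s(2) t(2)]) (simp only: s(3) t(3))
    with t(1) show ?thesis by simp
  qed
  then have "nn_order_integral M \<mu> (\<lambda>x. ennreal (h x)) = Fin s"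
    unfolding nn_order_integral_def
    using isLub_UNIV_unique \<phi> by (intro the_equality) blast+
  then show thesis using s(2,3) by (rule that)
qed

lemma order_integral_finite:
  assumes h: "h \<in> borel_measurable M" "\<And>x. x \<in> space M \<Longrightarrow> \<bar>h x\<bar> \<le> C"
    "\<And>x. x \<in> space M \<Longrightarrow> x \<notin> A \<Longrightarrow> h x = 0"
  shows "order_integrable M \<mu> h"
    and "\<exists>p n. order_integral M \<mu> h = p - n \<and> 0 \<le> p \<and> 0 \<le> n \<and> (\<forall>x'\<in>dual.
        ennreal (x' p) = (\<integral>\<^sup>+x. ennreal (max (h x) 0) \<partial>scalar_measure M \<mu> A x') \<and>
        ennreal (x' n) = (\<integral>\<^sup>+x. ennreal (max (- h x) 0) \<partial>scalar_measure M \<mu> A x'))"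
proof -
  have b: "0 \<le> \<bar>h x\<bar> \<and> \<bar>h x\<bar> \<le> C" "0 \<le> max (h x) 0 \<and> max (h x) 0 \<le> C" "0 \<le> max (- h x) 0 \<and> max (- h x) 0 \<le> C"
    if "x \<in> space M" for x using h(2)[OF that] by auto
  have z: "\<bar>h x\<bar> = 0" "max (h x) 0 = 0" "max (- h x) 0 = 0" if "x \<in> space M" "x \<notin> A" for x
    using h(3)[OF that] by auto
  have m: "(\<lambda>x. \<bar>h x\<bar>) \<in> borel_measurable M" "(\<lambda>x. max (h x) 0) \<in> borel_measurable M"
    "(\<lambda>x. max (- h x) 0) \<in> borel_measurable M"
    using h(1) by measurable
  obtain s where "nn_order_integral M \<mu> (\<lambda>x. ennreal \<bar>h x\<bar>) = Fin s"
    by (rule nn_order_integral_finite[OF m(1) b(1) z(1)])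
  then show "order_integrable M \<mu> h"
    using h(1) by (simp add: order_integrable_def)
  obtain p where p: "nn_order_integral M \<mu> (\<lambda>x. ennreal (max (h x) 0)) = Fin p" "0 \<le> p"
    "\<And>x'. x' \<in> dual \<Longrightarrow> ennreal (x' p) = (\<integral>\<^sup>+x. ennreal (max (h x) 0) \<partial>scalar_measure M \<mu> A x')"
    using nn_order_integral_finite[OF m(2) b(2) z(2)] by metis
  obtain n where n: "nn_order_integral M \<mu> (\<lambda>x. ennreal (max (- h x) 0)) = Fin n" "0 \<le> n"
    "\<And>x'. x' \<in> dual \<Longrightarrow> ennreal (x' n) = (\<integral>\<^sup>+x. ennreal (max (- h x) 0) \<partial>scalar_measure M \<mu> A x')"
    using nn_order_integral_finite[OF m(3) b(3) z(3)] by metis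
  have "order_integral M \<mu> h = p - n"
    unfolding order_integral_def p(1) n(1) by simp
  with p(2,3) n(2,3) show "\<exists>p n. order_integral M \<mu> h = p - n \<and> 0 \<le> p \<and> 0 \<le> n \<and> (\<forall>x'\<in>dual.
      ennreal (x' p) = (\<integral>\<^sup>+x. ennreal (max (h x) 0) \<partial>scalar_measure M \<mu> A x') \<and>
      ennreal (x' n) = (\<integral>\<^sup>+x. ennreal (max (- h x) 0) \<partial>scalar_measure M \<mu> A x'))"
    by blast
qed

lemma order_integral_nonneg_finite:
  assumes h: "h \<in> borel_measurable M" "\<And>x. x \<in> space M \<Longrightarrow> 0 \<le> h x \<and> h x \<le> C"
    "\<And>x. x \<in> space M \<Longrightarrow> x \<notin> A \<Longrightarrow> h x = 0" and x': "x' \<in> dual"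
  shows "ennreal (x' (order_integral M \<mu> h)) = (\<integral>\<^sup>+x. ennreal (h x) \<partial>scalar_measure M \<mu> A x')"
    and "0 \<le> order_integral M \<mu> h"
proof -
  have b: "\<bar>h x\<bar> \<le> C" if "x \<in> space M" for x using h(2)[OF that] by simp
  obtain p n where pn: "order_integral M \<mu> h = p - n" "0 \<le> p" "0 \<le> n" "\<forall>x'\<in>dual.
      ennreal (x' p) = (\<integral>\<^sup>+x. ennreal (max (h x) 0) \<partial>scalar_measure M \<mu> A x') \<and>
      ennreal (x' n) = (\<integral>\<^sup>+x. ennreal (max (- h x) 0) \<partial>scalar_measure M \<mu> A x')"
    using order_integral_finite(2)[OF h(1) b h(3)] by blast
  have pos: "(\<integral>\<^sup>+x. ennreal (max (h x) 0) \<partial>N) = (\<integral>\<^sup>+x. ennreal (h x) \<partial>N)" if "space N = space M" for N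
    using h(2) that by (intro nn_integral_cong) (simp add: max_absorb1)
  have neg: "(\<integral>\<^sup>+x. ennreal (max (- h x) 0) \<partial>N) = (\<integral>\<^sup>+x. 0 \<partial>N)" if "space N = space M" for N
    using h(2) that by (intro nn_integral_cong) (simp add: max_absorb2)
  have "n = 0"
  proof (rule eq_dual_ennrealI[OF pn(3) order_refl])
    fix y' assume y': "y' \<in> dual"
    show "ennreal (y' n) = ennreal (y' 0)"
      unfolding bspec[OF pn(4) y', THEN conjunct2] dual_zero[OF y'] by (subst neg) simp_all
  qed
  then have eq: "order_integral M \<mu> h = p" using pn(1) by simp
  show "ennreal (x' (order_integral M \<mu> h)) = (\<integral>\<^sup>+x. ennreal (h x) \<partial>scalar_measure M \<mu> A x')"
    unfolding eq bspec[OF pn(4) x', THEN conjunct1] by (rule pos) simp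
  show "0 \<le> order_integral M \<mu> h" unfolding eq by (rule pn(2))
qed

end

end

section \<open>Normed vector lattices\<close>

lemma ordered_nonneg_if_uminus_le:
  fixes a :: "'e::ordered_real_vector"
  assumes "- a \<le> a"
  shows "0 \<le> a"
proof -
  have "0 \<le> a + a" using add_right_mono[OF assms, of a] by simp
  then have "(1/2) *\<^sub>R 0 \<le> (1/2) *\<^sub>R (a + a)" by (intro scaleR_left_mono) auto
  also have "(1/2) *\<^sub>R (a + a) = a" by (simp flip: scaleR_2)
  finally show ?thesis by simp
qed

text \<open>\<open>y\<close> dominates the absolute value of \<open>x\<close> and is its own
  absolute value, so the lattice norm axiom applies.\<close>

lemma normed_vector_lattice_norm_bound:
  fixes x y :: "'e::{ordered_real_vector,real_normed_vector}"
  assumes E: "normed_vector_lattice TYPE('e)" and xy: "x \<le> y" "- x \<le> y"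
  shows "norm x \<le> norm y"
proof -
  obtain a where a: "isLub UNIV {x, - x} a"
    using E unfolding normed_vector_lattice_def vector_lattice_def by blast
  then have "a \<le> y" using xy by (simp add: isLub_UNIV_iff)
  have "- y \<le> y" using xy by (meson minus_le_iff order_trans)
  then have "isLub UNIV {y, - y} y" by (auto simp: isLub_UNIV_iff)
  then show ?thesis
    using E a \<open>a \<le> y\<close> unfolding normed_vector_lattice_def by blast
qed

text \<open>The positive part lies below the absolute value of \<open>x\<close>. It serves to write
  an element without sign as a difference of positive ones under control of the norms.\<close>

lemma normed_vector_lattice_pos_part:
  fixes x :: "'e::{ordered_real_vector,real_normed_vector}"
  assumes E: "normed_vector_lattice TYPE('e)"
  obtains p where "0 \<le> p" "x \<le> p" "norm p \<le> norm x"
proof -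
  obtain p where p: "isLub UNIV {x, 0} p"
    using E unfolding normed_vector_lattice_def vector_lattice_def by blast
  obtain a where a: "isLub UNIV {x, - x} a"
    using E unfolding normed_vector_lattice_def vector_lattice_def by blast
  have p0: "0 \<le> p" "x \<le> p" using p by (auto simp: isLub_UNIV_iff)
  have xa: "x \<le> a" "- x \<le> a" using a by (auto simp: isLub_UNIV_iff)
  then have "- a \<le> a" by (meson minus_le_iff order_trans)
  then have "0 \<le> a" by (rule ordered_nonneg_if_uminus_le)
  then have "p \<le> a" using p xa by (simp add: isLub_UNIV_iff)
  have "isLub UNIV {p, - p} p"
    using p0(1) by (auto simp: isLub_UNIV_iff intro: order_trans[of _ 0])
  then have "norm p \<le> norm x"
    using E a \<open>p \<le> a\<close> unfolding normed_vector_lattice_def by blast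
  with p0 show thesis by (rule that)
qed

section \<open>Positive operators on functions with compact support\<close>

locale positive_cc_operator = order_continuous_normed_space E
  for E :: "'e::{ordered_real_vector,real_normed_vector} itself" +
  fixes \<pi> :: "'x::t2_space cc \<Rightarrow> 'e"
  assumes lc: "locally_compact_space (euclidean :: 'x topology)"
    and pos: "positive_operator \<pi>"
    and summable_bound: "\<And>x :: nat \<Rightarrow> 'e. (\<And>n. 0 \<le> x n) \<Longrightarrow> summable (\<lambda>n. norm (x n)) \<Longrightarrow>
           \<exists>s. isLub UNIV (range (\<lambda>N. Fin (\<Sum>n\<le>N. x n))) (Fin s)"
begin

lemma linear: "linear \<pi>"
  using pos by (simp add: positive_operator_def)

lemmas add = linear_add[OF linear] and diff = linear_diff[OF linear]
  and scale = linear_scale[OF linear] and zero = linear_0[OF linear]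

lemma nonneg: "0 \<le> f \<Longrightarrow> 0 \<le> \<pi> f"
  using pos by (simp add: positive_operator_def)

lemma mono: "f \<le> g \<Longrightarrow> \<pi> f \<le> \<pi> g"
  using nonneg[of "g - f"] by (simp add: diff)

lemma functional:
  assumes "x' \<in> dual"
  shows "positive_functional (\<lambda>f. x' (\<pi> f))"
proof
  have "linear (x' \<circ> \<pi>)"
    using linear_compose[OF linear dual_linear[OF assms]] .
  then show "positive_operator (\<lambda>f. x' (\<pi> f))"
    using dual_nonneg[OF assms] nonneg by (simp add: positive_operator_def o_def)
qed (rule lc)

abbreviation content :: "('e \<Rightarrow> real) \<Rightarrow> 'x set \<Rightarrow> ennreal" where
  "content x' \<equiv> positive_functional.outer_content (\<lambda>f. x' (\<pi> f))"

abbreviation below :: "'x set \<Rightarrow> 'e set" where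
  "below V \<equiv> {\<pi> f |f. f \<prec>\<^sub>s V}"

text \<open>The pointwise maximum of two functions is supported in the union of their
  supports.\<close>

lemma below_upward: "upward (below V)"
  unfolding upward_def
proof (intro conjI ballI)
  show "below V \<noteq> {}" using zero_prec_below by blast
  fix a b assume "a \<in> below V" "b \<in> below V"
  then obtain f g where fg: "f \<prec>\<^sub>s V" "a = \<pi> f" "g \<prec>\<^sub>s V" "b = \<pi> g" by blast
  have sub: "{x. max (apply_cc f x) (apply_cc g x) \<noteq> 0} \<subseteq> {x. apply_cc f x \<noteq> 0} \<union> {x. apply_cc g x \<noteq> 0}"
    by auto
  have "\<exists>h. apply_cc h = (\<lambda>x. max (apply_cc f x) (apply_cc g x))"
  proof (rule cc_exists)
    show "compact (closure {x. apply_cc f x \<noteq> 0} \<union> closure {x. apply_cc g x \<noteq> 0})"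
      by (intro compact_Un compact_support_cc)
    show "max (apply_cc f x) (apply_cc g x) = 0"
      if "x \<notin> closure {x. apply_cc f x \<noteq> 0} \<union> closure {x. apply_cc g x \<noteq> 0}" for x
      using that cc_zero_outside[of x f] cc_zero_outside[of x g] by simp
  qed (intro continuous_on_max continuous_on_cc)
  then obtain h where h: "\<And>x. apply_cc h x = max (apply_cc f x) (apply_cc g x)" by metis
  have "closure {x. apply_cc h x \<noteq> 0} \<subseteq> closure {x. apply_cc f x \<noteq> 0} \<union> closure {x. apply_cc g x \<noteq> 0}"
    using closure_mono[OF sub] by (simp add: h closure_Un)
  then have "h \<prec>\<^sub>s V"
    using fg(1,3) by (auto simp: prec_below_def h intro: le_max_iff_disj[THEN iffD2])
  moreover have "a \<le> \<pi> h" "b \<le> \<pi> h"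
    unfolding fg by (auto intro!: mono simp: less_eq_cc.rep_eq h)
  ultimately show "\<exists>c\<in>below V. a \<le> c \<and> b \<le> c" by blast
qed

section \<open>Contents with values in the ordered space\<close>

definition bounded_open :: "'x set \<Rightarrow> bool" where
  "bounded_open V \<longleftrightarrow> open V \<and> bdd_above (below V)"

lemma bounded_open_subset: "bounded_open V \<Longrightarrow> open U \<Longrightarrow> U \<subseteq> V \<Longrightarrow> bounded_open U"
proof -
  assume V: "bounded_open V" and U: "open U" "U \<subseteq> V"
  have "below U \<subseteq> below V" using prec_below_mono[OF U(2)] by blast
  then show "bounded_open U"
    using V U(1) unfolding bounded_open_def bdd_above_def by (meson subsetD)
qed

text \<open>Without \<open>0 \<le> e\<close>, a negative value \<open>x' e\<close> would pass for
  content 0, and \<open>e\<close> would not be determined by \<open>A\<close>.\<close>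

definition has_content :: "'x set \<Rightarrow> 'e \<Rightarrow> bool" where
  "has_content A e \<longleftrightarrow> 0 \<le> e \<and> (\<forall>x'\<in>dual. ennreal (x' e) = content x' A)"

lemma has_content_nonneg: "has_content A e \<Longrightarrow> 0 \<le> e"
  by (simp add: has_content_def)

lemma has_contentD: "has_content A e \<Longrightarrow> x' \<in> dual \<Longrightarrow> ennreal (x' e) = content x' A"
  by (simp add: has_content_def)

lemma content_mono: "x' \<in> dual \<Longrightarrow> A \<subseteq> B \<Longrightarrow> content x' A \<le> content x' B"
  by (rule positive_functional.outer_content_mono[OF functional])

lemma has_content_mono: "has_content A a \<Longrightarrow> has_content B b \<Longrightarrow> A \<subseteq> B \<Longrightarrow> a \<le> b"
  by (rule le_dual_ennrealI) (auto simp: has_content_nonneg has_contentD content_mono)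

lemma has_content_unique: "has_content A a \<Longrightarrow> has_content A b \<Longrightarrow> a = b"
  by (simp add: antisym has_content_mono)

lemma content_open:
  assumes "x' \<in> dual" "open V"
  shows "content x' V = (SUP b\<in>below V. ennreal (x' b))"
proof -
  interpret F: positive_functional "\<lambda>f. x' (\<pi> f)" by (rule functional[OF assms(1)])
  have "below V = \<pi> ` {f. f \<prec>\<^sub>s V}" by blast
  then show ?thesis
    by (simp add: F.outer_content_open[OF assms(2)] F.open_content_def image_image)
qed

lemma bounded_open_lub:
  assumes "bounded_open V"
  obtains s where "isLub UNIV (below V) s" "has_content V s"
proof -
  have V: "open V" "bdd_above (below V)" using assms by (auto simp: bounded_open_def)
  obtain s where s: "isLub UNIV (below V) s"
    using upward_sup_exists[OF below_upward V(2)] by blast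
  have "\<pi> 0 \<in> below V" using zero_prec_below by blast
  then have "0 \<le> s" using s by (auto simp: isLub_UNIV_iff zero)
  moreover have "ennreal (x' s) = content x' V" if "x' \<in> dual" for x'
    using dual_sup[OF that below_upward s] content_open[OF that V(1)] by simp
  ultimately show thesis using that s by (simp add: has_content_def)
qed

definition content_finite :: "'x set \<Rightarrow> bool" where
  "content_finite A \<longleftrightarrow> (\<exists>V. bounded_open V \<and> A \<subseteq> V)"

text \<open>Intersections make the family of neighbourhoods directed downwards. An open
  \<open>U\<close> around \<open>A\<close> can be replaced by \<open>U \<inter> V0\<close>, with
  \<open>V0\<close> bounded, without raising its content; so bounded neighbourhoods suffice to
  compute the scalar outer contents. The approximation in norm is what later permits a choice of
  neighbourhoods with summable errors.\<close>

lemma content_finite_glb: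
  assumes "content_finite A"
  obtains e where "isGlb UNIV {v. \<exists>V. bounded_open V \<and> A \<subseteq> V \<and> has_content V v} e" "has_content A e"
    "\<forall>\<epsilon>>0. \<exists>V v. bounded_open V \<and> A \<subseteq> V \<and> has_content V v \<and> norm (v - e) < \<epsilon>"
proof -
  define S where "S = {v. \<exists>V. bounded_open V \<and> A \<subseteq> V \<and> has_content V v}"
  obtain V0 where V0: "bounded_open V0" "A \<subseteq> V0"
    using assms by (auto simp: content_finite_def)
  have int: "bounded_open (U \<inter> V)" if "open U" "bounded_open V" for U V
    using that by (intro bounded_open_subset[OF that(2)]) (auto simp: bounded_open_def open_Int)
  have "downward S"
    unfolding downward_def
  proof (intro conjI ballI)
    show "S \<noteq> {}" using V0 bounded_open_lub unfolding S_def by blast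
    fix a b assume "a \<in> S" "b \<in> S"
    then obtain U V where UV: "bounded_open U" "A \<subseteq> U" "has_content U a"
        "bounded_open V" "A \<subseteq> V" "has_content V b"
      by (auto simp: S_def)
    have "bounded_open (U \<inter> V)" using int UV by (simp add: bounded_open_def)
    then obtain c where c: "has_content (U \<inter> V) c" using bounded_open_lub by blast
    then have "c \<in> S" using \<open>bounded_open (U \<inter> V)\<close> UV(2,5) by (auto simp: S_def)
    moreover have "c \<le> a" "c \<le> b" using has_content_mono[OF c] UV(3,6) by auto
    ultimately show "\<exists>c\<in>S. c \<le> a \<and> c \<le> b" by blast
  qed
  moreover have "bdd_below S"
    by (rule bdd_belowI[of _ 0]) (auto simp: S_def has_content_nonneg)
  ultimately obtain e where e: "isGlb UNIV S e" using downward_inf_exists by blast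
  have "ennreal (x' e) = content x' A" if x': "x' \<in> dual" for x'
  proof -
    interpret F: positive_functional "\<lambda>f. x' (\<pi> f)" by (rule functional[OF x'])
    have "(INF v\<in>S. ennreal (x' v)) = F.outer_content A"
    proof (rule antisym)
      show "F.outer_content A \<le> (INF v\<in>S. ennreal (x' v))"
        by (intro INF_greatest) (auto simp: S_def has_contentD[OF _ x'] intro: F.outer_content_mono)
      show "(INF v\<in>S. ennreal (x' v)) \<le> F.outer_content A"
        unfolding F.outer_content_def[of A]
      proof (rule INF_greatest, clarify)
        fix U assume U: "open U" "A \<subseteq> U"
        have b: "bounded_open (U \<inter> V0)" using int U(1) V0(1) .
        then obtain c where c: "has_content (U \<inter> V0) c" using bounded_open_lub by blast
        then have "c \<in> S" using b U(2) V0(2) by (auto simp: S_def)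
        then have "(INF v\<in>S. ennreal (x' v)) \<le> ennreal (x' c)" by (intro INF_lower)
        also have "\<dots> \<le> F.open_content U"
          unfolding has_contentD[OF c x'] F.outer_content_open[OF U(1), symmetric]
          by (intro F.outer_content_mono) simp
        finally show "(INF v\<in>S. ennreal (x' v)) \<le> F.open_content U" .
      qed
    qed
    then show ?thesis using dual_inf[OF x' \<open>downward S\<close> e] by simp
  qed
  moreover have "\<forall>v\<in>S. 0 \<le> v" by (auto simp: S_def has_content_nonneg)
  then have "0 \<le> e" using e unfolding isGlb_UNIV_iff by simp
  ultimately have "has_content A e" by (simp add: has_content_def)
  moreover have "\<exists>V v. bounded_open V \<and> A \<subseteq> V \<and> has_content V v \<and> norm (v - e) < \<epsilon>" if "0 < \<epsilon>" for \<epsilon>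
    using downward_inf_norm[OF \<open>downward S\<close> e that] by (auto simp: S_def)
  ultimately show thesis using that[OF e[unfolded S_def]] by blast
qed

section \<open>The vector measure and its countable additivity\<close>

definition riesz_measure :: "'x set \<Rightarrow> 'e with_inf" where
  "riesz_measure = (\<lambda>A\<in>sets borel. if content_finite A then Fin (THE e. has_content A e) else Infty)"

lemma riesz_measure_Fin:
  assumes "A \<in> sets borel" "has_content A e" "content_finite A"
  shows "riesz_measure A = Fin e"
  using assms has_content_unique by (auto simp: riesz_measure_def)

lemma riesz_measure_Infty: "A \<in> sets borel \<Longrightarrow> \<not> content_finite A \<Longrightarrow> riesz_measure A = Infty"
  by (simp add: riesz_measure_def)

lemma riesz_measure_cases:
  assumes "A \<in> sets borel"
  obtains (finite) e where "content_finite A" "has_content A e" "riesz_measure A = Fin e"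
    | (infinite) "\<not> content_finite A" "riesz_measure A = Infty"
proof (cases "content_finite A")
  case True
  then obtain e where "has_content A e" using content_finite_glb by blast
  then show thesis using True riesz_measure_Fin[OF assms] finite by blast
next
  case False
  then show thesis using riesz_measure_Infty[OF assms] infinite by blast
qed

lemma content_finite_subset: "content_finite B \<Longrightarrow> A \<subseteq> B \<Longrightarrow> content_finite A"
  unfolding content_finite_def by blast

lemma riesz_measure_mono:
  assumes "A \<in> sets borel" "B \<in> sets borel" "A \<subseteq> B"
  shows "riesz_measure A \<le> riesz_measure B"
  using assms(2)
proof (cases rule: riesz_measure_cases)
  case B: (finite b)
  from assms(1) show ?thesis
  proof (cases rule: riesz_measure_cases)
    case (finite a)
    then show ?thesis using B assms(3) has_content_mono by simp
  next
    case infinite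
    then show ?thesis using B(1) assms(3) content_finite_subset by blast
  qed
qed simp

text \<open>
  The open neighbourhoods \<open>V n\<close> of \<open>A n\<close> are chosen so close in norm that the errors are summable;
  the second hypothesis on \<open>E\<close> then bounds the total error by a finite element.
\<close>

lemma content_finite_UN:
  fixes A :: "nat \<Rightarrow> 'x set"
  assumes "\<And>n. A n \<in> sets borel" "\<And>N. (\<Sum>n\<le>N. riesz_measure (A n)) \<le> Fin b"
  shows "content_finite (\<Union>n. A n)"
proof -
  have nn: "0 \<le> riesz_measure (A n)" for n
    using assms(1)[of n] by (cases rule: riesz_measure_cases) (auto simp: has_content_nonneg)
  have "\<exists>V v e. bounded_open V \<and> A n \<subseteq> V \<and> has_content V v \<and> has_content (A n) e \<and>
      norm (v - e) < (1/2) ^ n \<and> riesz_measure (A n) = Fin e" for n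
    using assms(1)[of n]
  proof (cases rule: riesz_measure_cases)
    case (finite e)
    obtain e' where e': "has_content (A n) e'"
      "\<forall>\<epsilon>>0. \<exists>V v. bounded_open V \<and> A n \<subseteq> V \<and> has_content V v \<and> norm (v - e') < \<epsilon>"
      by (rule content_finite_glb[OF finite(1)]) (rule that)
    have "e' = e" using has_content_unique[OF e'(1) finite(2)] .
    moreover obtain V v where "bounded_open V" "A n \<subseteq> V" "has_content V v" "norm (v - e') < (1/2) ^ n"
      using e'(2)[rule_format, of "(1/2) ^ n"] by auto
    ultimately show ?thesis using finite(2,3) by blast
  next
    case infinite
    have "riesz_measure (A n) \<le> (\<Sum>n\<le>n. riesz_measure (A n))"
      using nn by (intro with_inf_member_le_sum) auto
    then show ?thesis using infinite(2) assms(2)[of n] by (auto simp: le_Fin_iff)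
  qed
  then obtain V v e where V: "\<And>n. bounded_open (V n)" "\<And>n. A n \<subseteq> V n" "\<And>n. has_content (V n) (v n)"
      "\<And>n. has_content (A n) (e n)" "\<And>n. norm (v n - e n) < (1/2) ^ n" "\<And>n. riesz_measure (A n) = Fin (e n)"
    by metis
  have "summable (\<lambda>n. norm (v n - e n))"
    by (rule summable_comparison_test'[of "\<lambda>n. (1/2) ^ n" 0]) (use V(5) in \<open>auto intro: less_imp_le\<close>)
  moreover have "0 \<le> v n - e n" for n
    using has_content_mono[OF V(4) V(3) V(2)] by simp
  ultimately obtain c where "isLub UNIV (range (\<lambda>N. Fin (\<Sum>n\<le>N. v n - e n))) (Fin c)"
    using summable_bound[of "\<lambda>n. v n - e n"] by blast
  then have "(\<Sum>n\<le>N. v n - e n) \<le> c" for N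
    unfolding isLub_UNIV_iff by (metis Fin_le_Fin rangeI)
  moreover have "(\<Sum>n\<le>N. e n) \<le> b" for N
    using assms(2)[of N] by (simp add: V(6) Fin_sum)
  ultimately have sum_v: "(\<Sum>n\<le>N. v n) \<le> b + c" for N
    using add_mono[of "\<Sum>n\<le>N. e n" b "\<Sum>n\<le>N. v n - e n" c] by (simp flip: sum.distrib)
  have v0: "0 \<le> v n" for n by (rule has_content_nonneg[OF V(3)])
  have "0 \<le> b + c" using sum_v[of 0] v0[of 0] by simp
  have "open (V n)" for n using V(1) by (simp add: bounded_open_def)
  \<comment> \<open>Order boundedness for the union is obtained functional by functional: scalar
    countable subadditivity bounds \<open>x' (\<pi> f)\<close> by the series of the
    \<open>x' (v n)\<close>, whose partial sums stay below \<open>x' (b + c)\<close>.\<close>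
  have "\<pi> f \<le> b + c" if f: "f \<prec>\<^sub>s (\<Union>n. V n)" for f
  proof (rule le_dual_ennrealI[OF \<open>0 \<le> b + c\<close>])
    fix x' assume x': "x' \<in> dual"
    interpret F: positive_functional "\<lambda>f. x' (\<pi> f)" by (rule functional[OF x'])
    have "ennreal (x' (\<pi> f)) \<le> (\<Sum>n. F.open_content (V n))"
      using F.open_content_upper[OF f] F.open_content_UN[of V, OF \<open>\<And>n. open (V n)\<close>] by (rule order_trans)
    also have "\<dots> = (\<Sum>n. ennreal (x' (v n)))"
      by (simp only: has_contentD[OF V(3) x'] F.outer_content_open[OF \<open>\<And>n. open (V n)\<close>])
    also have "\<dots> = (SUP N. \<Sum>n\<le>N. ennreal (x' (v n)))"
      by (rule SUP_partial_sums[symmetric])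
    also have "\<dots> \<le> ennreal (x' (b + c))"
    proof (rule SUP_least)
      fix N
      have "(\<Sum>n\<le>N. ennreal (x' (v n))) = ennreal (x' (\<Sum>n\<le>N. v n))"
        using dual_nonneg[OF x' v0] by (simp add: sum_ennreal dual_sum[OF x'])
      also have "\<dots> \<le> ennreal (x' (b + c))"
        by (intro ennreal_leI dual_mono[OF x'] sum_v)
      finally show "(\<Sum>n\<le>N. ennreal (x' (v n))) \<le> ennreal (x' (b + c))" .
    qed
    finally show "ennreal (x' (\<pi> f)) \<le> ennreal (x' (b + c))" .
  qed
  then have "bounded_open (\<Union>n. V n)"
    using \<open>\<And>n. open (V n)\<close> by (auto simp: bounded_open_def intro!: bdd_aboveI[of _ "b + c"])
  moreover have "(\<Union>n. A n) \<subseteq> (\<Union>n. V n)" using V(2) by blast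
  ultimately show ?thesis unfolding content_finite_def by blast
qed

text \<open>If the union is content-finite, so are its parts, and additivity of the scalar Riesz
  measures is lifted. Otherwise \<open>content_finite_UN\<close> excludes every finite upper bound
  of the partial sums, which leaves \<open>Infty\<close> as the only one.\<close>

lemma positive_measure_riesz_measure: "positive_measure borel riesz_measure"
  unfolding positive_measure_def
proof (intro conjI allI impI)
  show "riesz_measure \<in> sets borel \<rightarrow>\<^sub>E {0..}"
  proof
    fix A :: "'x set" assume "A \<in> sets borel"
    then show "riesz_measure A \<in> {0..}"
      by (cases rule: riesz_measure_cases) (auto simp: has_content_nonneg)
  qed (simp add: riesz_measure_def)
  have "below {} = {0}" by (simp add: zero)
  then have "bdd_above (below {})" unfolding bdd_above_def by auto
  then have "content_finite {}" by (auto simp: content_finite_def bounded_open_def intro!: exI[of _ "{}"])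
  moreover have "has_content {} 0"
    using positive_functional.outer_content_empty[OF functional] by (simp add: has_content_def dual_zero)
  ultimately show "riesz_measure {} = 0"
    by (simp add: riesz_measure_Fin zero_with_inf_def)
  fix A :: "nat \<Rightarrow> 'x set" assume "range A \<subseteq> sets borel \<and> disjoint_family A"
  then have A: "\<And>n. A n \<in> sets borel" "disjoint_family A" by auto
  then have U: "(\<Union>n. A n) \<in> sets borel" by blast
  show "isLub UNIV (range (\<lambda>N. \<Sum>n\<le>N. riesz_measure (A n))) (riesz_measure (\<Union>n. A n))"
    using U
  proof (cases rule: riesz_measure_cases)
    case (finite s)
    have "\<exists>e. has_content (A n) e \<and> riesz_measure (A n) = Fin e" for n
      using A(1)[of n] content_finite_subset[OF finite(1), of "A n"]
      by (cases rule: riesz_measure_cases) auto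
    then obtain e where e: "\<And>n. has_content (A n) (e n)" "\<And>n. riesz_measure (A n) = Fin (e n)" by metis
    have e0: "0 \<le> e n" for n by (rule has_content_nonneg[OF e(1)])
    have s: "ennreal (x' s) = (SUP N. ennreal (x' (\<Sum>n\<le>N. e n)))" if x': "x' \<in> dual" for x'
    proof -
      interpret F: positive_functional "\<lambda>f. x' (\<pi> f)" by (rule functional[OF x'])
      have "ennreal (x' s) = emeasure F.riesz (\<Union>n. A n)"
        by (simp add: has_contentD[OF finite(2) x'] F.emeasure_riesz U)
      also have "\<dots> = (\<Sum>n. emeasure F.riesz (A n))"
        using A by (intro suminf_emeasure[symmetric]) auto
      also have "\<dots> = (\<Sum>n. ennreal (x' (e n)))"
        by (simp add: has_contentD[OF e(1) x'] F.emeasure_riesz A(1))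
      also have "\<dots> = (SUP N. \<Sum>n\<le>N. ennreal (x' (e n)))" by (rule SUP_partial_sums[symmetric])
      also have "\<dots> = (SUP N. ennreal (x' (\<Sum>n\<le>N. e n)))"
        using dual_nonneg[OF x' e0] by (simp add: sum_ennreal dual_sum[OF x'])
      finally show ?thesis .
    qed
    have "isLub UNIV (range (\<lambda>N. \<Sum>n\<le>N. e n)) s"
      unfolding isLub_UNIV_iff
    proof (intro conjI ballI allI impI)
      fix y assume "y \<in> range (\<lambda>N. \<Sum>n\<le>N. e n)"
      then obtain N where N: "y = (\<Sum>n\<le>N. e n)" by blast
      show "y \<le> s"
      proof (rule le_dual_ennrealI[OF has_content_nonneg[OF finite(2)]])
        fix x' assume "x' \<in> dual"
        show "ennreal (x' y) \<le> ennreal (x' s)"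
          unfolding s[OF \<open>x' \<in> dual\<close>] N by (rule SUP_upper) simp
      qed
    next
      fix u assume u: "\<forall>y\<in>range (\<lambda>N. \<Sum>n\<le>N. e n). y \<le> u"
      then have "(\<Sum>n\<le>0. e n) \<le> u" by blast
      then have "0 \<le> u" using e0[of 0] by simp
      then show "s \<le> u"
      proof (rule le_dual_ennrealI)
        fix x' assume "x' \<in> dual"
        show "ennreal (x' s) \<le> ennreal (x' u)"
          unfolding s[OF \<open>x' \<in> dual\<close>] using u by (intro SUP_least ennreal_leI dual_mono[OF \<open>x' \<in> dual\<close>]) blast
      qed
    qed
    then have "isLub UNIV (Fin ` range (\<lambda>N. \<Sum>n\<le>N. e n)) (Fin s)" by (simp add: isLub_Fin_iff)
    then show ?thesis by (simp add: e(2) finite(3) Fin_sum image_image)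
  next
    case infinite
    have "u = Infty" if "\<forall>y\<in>range (\<lambda>N. \<Sum>n\<le>N. riesz_measure (A n)). y \<le> u" for u
    proof (cases u)
      case (Fin b)
      then show ?thesis using content_finite_UN[of A b, OF A(1)] that infinite(1) by blast
    qed
    then show ?thesis by (auto simp: isLub_UNIV_iff infinite(2))
  qed
qed

section \<open>Existence\<close>

text \<open>A Urysohn function \<open>g\<close> that is 1 on an open set \<open>W\<close> around
  \<open>K\<close> dominates every \<open>f \<prec>\<^sub>s W\<close>, so \<open>\<pi> g\<close>
  bounds \<open>below W\<close>.\<close>

lemma content_finite_compact:
  assumes "compact K"
  shows "content_finite K"
proof -
  obtain g W where W: "open W" "K \<subseteq> W" "W \<prec>\<^sub>f g" "g \<prec>\<^sub>s (UNIV :: 'x set)"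
    by (rule cc_urysohn[OF lc assms open_UNIV subset_UNIV])
  have "\<pi> f \<le> \<pi> g" if f: "f \<prec>\<^sub>s W" for f
  proof (rule mono, unfold less_eq_cc.rep_eq, rule allI)
    fix x
    show "apply_cc f x \<le> apply_cc g x"
    proof (cases "x \<in> W")
      case True
      then show ?thesis using f W(3) by (simp add: prec_below_def prec_above_def)
    next
      case False
      then have "apply_cc f x = 0" using f cc_zero_outside[of x f] by (auto simp: prec_below_def)
      then show ?thesis using W(4) by (simp add: prec_below_def)
    qed
  qed
  then have "bounded_open W" using W(1) unfolding bounded_open_def bdd_above_def by blast
  then show ?thesis using W(2) unfolding content_finite_def by blast
qed

lemma riesz_measure_compact:
  assumes "compact K"
  obtains e where "riesz_measure K = Fin e" "has_content K e"
  using borel_compact[OF assms] content_finite_compact[OF assms]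
  by (cases rule: riesz_measure_cases) auto

lemma riesz_measure_ge:
  assumes "compact L" "\<And>x. 0 \<le> apply_cc f x" "\<And>x. apply_cc f x \<le> 1"
    and "\<And>x. x \<notin> L \<Longrightarrow> apply_cc f x = 0"
  shows "Fin (\<pi> f) \<le> riesz_measure L"
proof -
  obtain e where e: "riesz_measure L = Fin e" "has_content L e"
    using riesz_measure_compact[OF assms(1)] by blast
  have "\<pi> f \<le> e"
  proof (rule le_dual_ennrealI[OF has_content_nonneg[OF e(2)]])
    fix x' assume x': "x' \<in> dual"
    interpret F: positive_functional "\<lambda>f. x' (\<pi> f)" by (rule functional[OF x'])
    show "ennreal (x' (\<pi> f)) \<le> ennreal (x' e)"
      unfolding has_contentD[OF e(2) x'] by (rule F.outer_content_ge[OF assms(2,3,1,4)])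
  qed
  then show ?thesis by (simp add: e(1))
qed

text \<open>A finite upper bound \<open>b\<close> for the compact subsets bounds each
  \<open>\<pi> f\<close> with \<open>f \<prec>\<^sub>s V\<close>, since \<open>\<pi> f\<close> is at
  most the measure of the support of \<open>f\<close>. Thus \<open>V\<close> is a bounded open set,
  and its measure, the supremum of these \<open>\<pi> f\<close>, is at most
  \<open>b\<close>.\<close>

lemma inner_regular_riesz_measure:
  assumes V: "open V"
  shows "inner_regular_at riesz_measure V"
  unfolding inner_regular_at_def isLub_UNIV_iff
proof (intro conjI ballI allI impI)
  have Vb: "V \<in> sets borel" using V by simp
  show "y \<le> riesz_measure V" if "y \<in> {riesz_measure K |K. compact K \<and> K \<subseteq> V}" for y
    using that Vb by (auto intro: riesz_measure_mono borel_compact)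
  fix u assume u: "\<forall>y\<in>{riesz_measure K |K. compact K \<and> K \<subseteq> V}. y \<le> u"
  show "riesz_measure V \<le> u"
  proof (cases u)
    case (Fin b)
    have le: "\<pi> f \<le> b" if f: "f \<prec>\<^sub>s V" for f
    proof -
      define L where "L = closure {x. apply_cc f x \<noteq> 0}"
      have L: "compact L" "L \<subseteq> V" using f by (auto simp: L_def compact_support_cc prec_below_def)
      have f0: "apply_cc f x = 0" if "x \<notin> L" for x using that unfolding L_def by (rule cc_zero_outside)
      have "Fin (\<pi> f) \<le> riesz_measure L"
        using f by (intro riesz_measure_ge[OF L(1) _ _ f0]) (simp_all add: prec_below_def)
      also have "\<dots> \<le> Fin b" using u L Fin by blast
      finally show ?thesis by simp
    qed
    then have bV: "bounded_open V" using V unfolding bounded_open_def bdd_above_def by blast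
    obtain s where s: "isLub UNIV (below V) s" "has_content V s" by (rule bounded_open_lub[OF bV])
    have "content_finite V" using bV by (auto simp: content_finite_def)
    then have "riesz_measure V = Fin s" using riesz_measure_Fin[OF Vb s(2)] by blast
    moreover have "s \<le> b" using s(1) le unfolding isLub_UNIV_iff by blast
    ultimately show ?thesis by (simp add: Fin)
  qed simp
qed

text \<open>At infinite measure there is nothing to show for a lower bound \<open>u\<close>.
  Otherwise some bounded neighbourhood exists, which forces \<open>u\<close> to be finite, and
  \<open>u\<close> lies below the infimum over bounded neighbourhoods from
  \<open>content_finite_glb\<close>.\<close>

lemma outer_regular_riesz_measure:
  assumes A: "A \<in> sets borel"
  shows "outer_regular_at riesz_measure A"
  unfolding outer_regular_at_def isGlb_UNIV_iff
proof (intro conjI ballI allI impI)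
  show "riesz_measure A \<le> y" if "y \<in> {riesz_measure V |V. open V \<and> A \<subseteq> V}" for y
    using that A by (auto intro: riesz_measure_mono)
  fix u assume u: "\<forall>y\<in>{riesz_measure V |V. open V \<and> A \<subseteq> V}. u \<le> y"
  from A show "u \<le> riesz_measure A"
  proof (cases rule: riesz_measure_cases)
    case (finite e)
    obtain e' where e': "isGlb UNIV {v. \<exists>V. bounded_open V \<and> A \<subseteq> V \<and> has_content V v} e'" "has_content A e'"
      by (rule content_finite_glb[OF finite(1)]) (rule that)
    have "e' = e" by (rule has_content_unique[OF e'(2) finite(2)])
    have uv: "u \<le> Fin v" if "bounded_open V" "A \<subseteq> V" "has_content V v" for V v
    proof -
      have "open V" "content_finite V" using that(1) by (auto simp: bounded_open_def content_finite_def)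
      then have "riesz_measure V = Fin v" using riesz_measure_Fin that(3) by simp
      then show ?thesis using u \<open>open V\<close> that(2) by (metis (mono_tags, lifting) mem_Collect_eq)
    qed
    obtain V0 where V0: "bounded_open V0" "A \<subseteq> V0" using finite(1) by (auto simp: content_finite_def)
    obtain v0 where v0: "has_content V0 v0" using bounded_open_lub[OF V0(1)] by blast
    obtain a where a: "u = Fin a" using uv[OF V0 v0] by (auto simp: le_Fin_iff)
    have "\<forall>v\<in>{v. \<exists>V. bounded_open V \<and> A \<subseteq> V \<and> has_content V v}. a \<le> v"
      using uv by (auto simp: a)
    then have "a \<le> e'" using e'(1) unfolding isGlb_UNIV_iff by blast
    then show ?thesis by (simp add: a finite(3) \<open>e' = e\<close>)
  qed simp
qed

lemma regular_riesz_measure: "regular_borel_measure riesz_measure"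
  unfolding regular_borel_measure_def
proof (intro conjI allI ballI impI)
  fix K :: "'x set" assume "compact K"
  then obtain e where "riesz_measure K = Fin e" using riesz_measure_compact by blast
  then show "is_finite (riesz_measure K)" by simp
qed (intro positive_measure_riesz_measure inner_regular_riesz_measure outer_regular_riesz_measure; assumption)+

text \<open>The scalar measure is the Riesz measure of the functional with density
  \<open>indicator K\<close>, and off \<open>K\<close> the integrand vanishes.\<close>

lemma nn_integral_scalar_riesz_measure:
  assumes x': "x' \<in> dual" and K: "compact K" and g: "g \<in> borel_measurable borel" "\<And>x. x \<notin> K \<Longrightarrow> g x = 0"
  shows "(\<integral>\<^sup>+x. g x \<partial>scalar_measure borel riesz_measure K x')
    = (\<integral>\<^sup>+x. g x \<partial>positive_functional.riesz (\<lambda>f. x' (\<pi> f)))"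
proof -
  interpret F: positive_functional "\<lambda>f. x' (\<pi> f)" by (rule functional[OF x'])
  have Kb: "K \<in> sets borel" using K by (rule borel_compact)
  have fin: "is_finite (riesz_measure K)" using riesz_measure_compact[OF K] by (metis with_inf.disc(1))
  have "scalar_measure borel riesz_measure K x' = density F.riesz (indicator K)"
  proof (rule measure_eqI)
    fix B assume "B \<in> sets (scalar_measure borel riesz_measure K x')"
    then have B: "B \<in> sets borel" by simp
    then have BK: "B \<inter> K \<in> sets borel" using Kb by blast
    have "content_finite (B \<inter> K)"
      using content_finite_subset[OF content_finite_compact[OF K]] by blast
    with BK obtain e where e: "has_content (B \<inter> K) e" "riesz_measure (B \<inter> K) = Fin e"
      by (cases rule: riesz_measure_cases) auto
    have "emeasure (scalar_measure borel riesz_measure K x') B = emeasure F.riesz (B \<inter> K)"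
      using emeasure_scalar_measure[OF positive_measure_riesz_measure Kb fin x' B] has_contentD[OF e(1) x']
      by (simp add: e(2) F.emeasure_riesz[OF BK])
    also have "\<dots> = (\<integral>\<^sup>+x. indicator (B \<inter> K) x \<partial>F.riesz)"
      using BK by simp
    also have "\<dots> = (\<integral>\<^sup>+x. indicator K x * indicator B x \<partial>F.riesz)"
      by (intro nn_integral_cong) (auto split: split_indicator)
    also have "\<dots> = emeasure (density F.riesz (indicator K)) B"
      using B Kb by (intro emeasure_density[symmetric]) auto
    finally show "emeasure (scalar_measure borel riesz_measure K x') B = emeasure (density F.riesz (indicator K)) B" .
  qed simp
  then have "(\<integral>\<^sup>+x. g x \<partial>scalar_measure borel riesz_measure K x') = (\<integral>\<^sup>+x. indicator K x * g x \<partial>F.riesz)"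
    using g(1) Kb by (simp add: nn_integral_density)
  also have "\<dots> = (\<integral>\<^sup>+x. g x \<partial>F.riesz)"
    using g(2) by (intro nn_integral_cong) (auto split: split_indicator)
  finally show ?thesis .
qed

lemma represents_riesz_measure: "represents riesz_measure \<pi>"
  unfolding represents_def
proof (intro conjI allI regular_riesz_measure)
  fix f :: "'x cc"
  define K where "K = closure {x. apply_cc f x \<noteq> 0}"
  have K: "compact K" by (simp add: K_def compact_support_cc)
  have Kb: "K \<in> sets borel" using K by (rule borel_compact)
  have fin: "is_finite (riesz_measure K)" using riesz_measure_compact[OF K] by (metis with_inf.disc(1))
  have f0: "apply_cc f x = 0" if "x \<notin> K" for x using that unfolding K_def by (rule cc_zero_outside)
  note int = order_integral_finite[OF positive_measure_riesz_measure Kb fin measurable_cc cc_abs_le_norm f0]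
  show "order_integrable borel riesz_measure (apply_cc f)" by (rule int(1))
  obtain p n where pn: "order_integral borel riesz_measure (apply_cc f) = p - n" "0 \<le> p" "0 \<le> n" "\<forall>x'\<in>dual.
      ennreal (x' p) = (\<integral>\<^sup>+x. ennreal (max (apply_cc f x) 0) \<partial>scalar_measure borel riesz_measure K x') \<and>
      ennreal (x' n) = (\<integral>\<^sup>+x. ennreal (max (- apply_cc f x) 0) \<partial>scalar_measure borel riesz_measure K x')"
    using int(2) by blast
  \<comment> \<open>Used twice, with \<open>f\<close> and with \<open>- f\<close> for
    \<open>h\<close>: the positive and the negative part are again in \<open>'x cc\<close>, and the
    scalar representation theorem applies to each.\<close>
  have eq: "\<pi> g = q"
    if g: "\<And>x. apply_cc g x = max (h x) 0" and q: "0 \<le> q" and h: "\<And>x. x \<notin> K \<Longrightarrow> h x = 0" "h \<in> borel_measurable borel"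
      and eq: "\<And>x'. x' \<in> dual \<Longrightarrow> ennreal (x' q) = (\<integral>\<^sup>+x. ennreal (max (h x) 0) \<partial>scalar_measure borel riesz_measure K x')"
    for g q h
  proof (rule eq_dual_ennrealI[OF _ q])
    show "0 \<le> \<pi> g" by (rule nonneg) (simp add: less_eq_cc.rep_eq zero_cc.rep_eq g)
    fix x' assume x': "x' \<in> dual"
    interpret F: positive_functional "\<lambda>f. x' (\<pi> f)" by (rule functional[OF x'])
    have "ennreal (x' (\<pi> g)) = (\<integral>\<^sup>+x. ennreal (apply_cc g x) \<partial>F.riesz)"
      by (rule F.nn_integral_riesz[symmetric]) (simp add: g)
    also have "\<dots> = ennreal (x' q)"
      unfolding eq[OF x'] g using h
      by (subst nn_integral_scalar_riesz_measure[OF x' K]) auto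
    finally show "ennreal (x' (\<pi> g)) = ennreal (x' q)" .
  qed
  obtain fp where fp: "\<And>x. apply_cc fp x = max (apply_cc f x) 0" using cc_pos_part by metis
  obtain fn where fn: "\<And>x. apply_cc fn x = max (- apply_cc f x) 0"
    using cc_pos_part[of "- f"] by (metis uminus_cc.rep_eq)
  have "\<pi> fp = p" by (rule eq[OF fp pn(2) f0]) (use pn(4) in auto)
  moreover have "\<pi> fn = n" by (rule eq[OF fn pn(3)]) (use pn(4) f0 in auto)
  moreover have "f = fp - fn" by (rule cc_eqI) (simp add: minus_cc.rep_eq fp fn)
  ultimately show "\<pi> f = order_integral borel riesz_measure (apply_cc f)"
    using diff pn(1) by metis
qed

section \<open>Uniqueness\<close>

context
  fixes \<mu> :: "'x set \<Rightarrow> 'e with_inf"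
  assumes \<mu>: "represents \<mu> \<pi>"
begin

lemma represents_positive_measure: "positive_measure borel \<mu>"
  and represents_compact_finite: "compact K \<Longrightarrow> is_finite (\<mu> K)"
  and represents_inner: "open V \<Longrightarrow> isLub UNIV {\<mu> K |K. compact K \<and> K \<subseteq> V} (\<mu> V)"
  and represents_outer: "A \<in> sets borel \<Longrightarrow> isGlb UNIV {\<mu> V |V. open V \<and> A \<subseteq> V} (\<mu> A)"
  and represents_integral: "order_integral borel \<mu> (apply_cc f) = \<pi> f"
  using \<mu> unfolding represents_def regular_borel_measure_def inner_regular_at_def outer_regular_at_def by auto

lemma dual_represents:
  assumes K: "compact K" "\<And>x. x \<notin> K \<Longrightarrow> apply_cc f x = 0" and f: "\<And>x. 0 \<le> apply_cc f x" and x': "x' \<in> dual"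
  shows "ennreal (x' (\<pi> f)) = (\<integral>\<^sup>+x. ennreal (apply_cc f x) \<partial>scalar_measure borel \<mu> K x')"
proof -
  have "0 \<le> apply_cc f x \<and> apply_cc f x \<le> norm f" for x
    using f cc_abs_le_norm[of f x] by simp
  then show ?thesis
    using order_integral_nonneg_finite(1)[OF represents_positive_measure borel_compact[OF K(1)]
        represents_compact_finite[OF K(1)] measurable_cc _ K(2) x', of "norm f"]
    by (simp add: represents_integral)
qed

lemma represents_compact_Fin:
  assumes "compact K"
  obtains e where "\<mu> K = Fin e" "0 \<le> e"
  using represents_compact_finite[OF assms]
    positive_measure_nonneg[OF represents_positive_measure borel_compact[OF assms]]
  by (cases "\<mu> K") auto

lemma represents_ge:
  assumes "compact L" "\<And>x. 0 \<le> apply_cc f x" "\<And>x. apply_cc f x \<le> 1"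
    and "\<And>x. x \<notin> L \<Longrightarrow> apply_cc f x = 0"
  shows "Fin (\<pi> f) \<le> \<mu> L"
proof -
  obtain e where e: "\<mu> L = Fin e" "0 \<le> e" using represents_compact_Fin[OF assms(1)] .
  have Lb: "L \<in> sets borel" using assms(1) by (rule borel_compact)
  have "\<pi> f \<le> e"
  proof (rule le_dual_ennrealI[OF e(2)])
    fix x' assume x': "x' \<in> dual"
    let ?N = "scalar_measure borel \<mu> L x'"
    have "ennreal (x' (\<pi> f)) = (\<integral>\<^sup>+x. ennreal (apply_cc f x) \<partial>?N)"
      by (rule dual_represents[OF assms(1,4,2) x'])
    also have "\<dots> \<le> (\<integral>\<^sup>+x. indicator L x \<partial>?N)"
      using assms(3,4) by (intro nn_integral_mono) (auto split: split_indicator)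
    also have "\<dots> = emeasure ?N L" using Lb by simp
    also have "\<dots> = ennreal (x' e)"
      using emeasure_scalar_measure[OF represents_positive_measure Lb represents_compact_finite[OF assms(1)] x' Lb]
      by (simp add: e(1))
    finally show "ennreal (x' (\<pi> f)) \<le> ennreal (x' e)" .
  qed
  then show ?thesis by (simp add: e(1))
qed

lemma represents_le:
  assumes K: "compact K" "\<And>x. x \<in> K \<Longrightarrow> 1 \<le> apply_cc f x" and f: "\<And>x. 0 \<le> apply_cc f x"
  shows "\<mu> K \<le> Fin (\<pi> f)"
proof -
  \<comment> \<open>The set to which \<open>\<mu>\<close> is restricted has to carry
    \<open>f\<close> as well as \<open>K\<close>, since \<open>\<pi> f\<close> becomes an integral
    over it.\<close>
  define L where "L = K \<union> closure {x. apply_cc f x \<noteq> 0}"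
  have L: "compact L" unfolding L_def by (intro compact_Un K(1) compact_support_cc)
  have Lb: "L \<in> sets borel" "K \<in> sets borel" using L K(1) by (auto intro: borel_compact)
  have f0: "apply_cc f x = 0" if "x \<notin> L" for x using that cc_zero_outside[of x f] by (simp add: L_def)
  obtain e where e: "\<mu> K = Fin e" using represents_compact_Fin[OF K(1)] by blast
  have "0 \<le> \<pi> f" by (rule nonneg) (simp add: less_eq_cc.rep_eq zero_cc.rep_eq f)
  then have "e \<le> \<pi> f"
  proof (rule le_dual_ennrealI)
    fix x' assume x': "x' \<in> dual"
    let ?N = "scalar_measure borel \<mu> L x'"
    have "K \<inter> L = K" by (auto simp: L_def)
    then have "ennreal (x' e) = emeasure ?N K"
      using emeasure_scalar_measure[OF represents_positive_measure Lb(1) represents_compact_finite[OF L] x' Lb(2)]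
      by (simp add: e)
    also have "\<dots> = (\<integral>\<^sup>+x. indicator K x \<partial>?N)" using Lb(2) by simp
    also have "\<dots> \<le> (\<integral>\<^sup>+x. ennreal (apply_cc f x) \<partial>?N)"
      using K(2) by (intro nn_integral_mono) (auto split: split_indicator)
    also have "\<dots> = ennreal (x' (\<pi> f))"
      by (rule dual_represents[OF L f0 f x', symmetric])
    finally show "ennreal (x' e) \<le> ennreal (x' (\<pi> f))" .
  qed
  then show ?thesis by (simp add: e)
qed

text \<open>By inner regularity an upper bound need only be checked on compact \<open>K\<close>
  inside \<open>V\<close>, where a Urysohn function gives
  \<open>\<mu> K \<le> Fin (\<pi> g)\<close>. Conversely, \<open>\<pi> f\<close> is at most the
  measure of the support of \<open>f\<close>.\<close>

lemma represents_open:
  assumes V: "open V"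
  shows "isLub UNIV {Fin (\<pi> f) |f. f \<prec>\<^sub>s V} (\<mu> V)"
  unfolding isLub_UNIV_iff
proof (intro conjI ballI allI impI)
  fix y assume "y \<in> {Fin (\<pi> f) |f. f \<prec>\<^sub>s V}"
  then obtain f where f: "y = Fin (\<pi> f)" "f \<prec>\<^sub>s V" by blast
  define L where "L = closure {x. apply_cc f x \<noteq> 0}"
  have L: "compact L" "L \<subseteq> V" using f(2) by (auto simp: L_def compact_support_cc prec_below_def)
  have f0: "apply_cc f x = 0" if "x \<notin> L" for x using that unfolding L_def by (rule cc_zero_outside)
  have "y \<le> \<mu> L"
    unfolding f(1) using f(2) by (intro represents_ge[OF L(1) _ _ f0]) (simp_all add: prec_below_def)
  also have "\<dots> \<le> \<mu> V"
    using L V by (intro positive_measure_mono[OF represents_positive_measure]) (auto intro: borel_compact)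
  finally show "y \<le> \<mu> V" .
next
  fix u assume u: "\<forall>y\<in>{Fin (\<pi> f) |f. f \<prec>\<^sub>s V}. y \<le> u"
  have "\<mu> K \<le> u" if K: "compact K" "K \<subseteq> V" for K
  proof -
    obtain g W where g: "K \<subseteq> W" "W \<prec>\<^sub>f g" "g \<prec>\<^sub>s V"
      by (rule cc_urysohn[OF lc K(1) V K(2)]) (rule that)
    have "\<mu> K \<le> Fin (\<pi> g)"
      using g(1,2) K(1) by (intro represents_le) (auto simp: prec_above_def)
    also have "\<dots> \<le> u" using u g(3) by blast
    finally show ?thesis .
  qed
  then show "\<mu> V \<le> u" using represents_inner[OF V] unfolding isLub_UNIV_iff by blast
qed

text \<open>By outer regularity a lower bound need only be checked on open \<open>V\<close> around
  \<open>K\<close>; the Urysohn function between \<open>K\<close> and \<open>V\<close> links it to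
  \<open>\<mu> V\<close> through \<open>represents_open\<close>.\<close>

lemma represents_compact:
  assumes K: "compact K"
  shows "isGlb UNIV {Fin (\<pi> f) |f. K \<prec>\<^sub>f f} (\<mu> K)"
  unfolding isGlb_UNIV_iff
proof (intro conjI ballI allI impI)
  show "\<mu> K \<le> y" if "y \<in> {Fin (\<pi> f) |f. K \<prec>\<^sub>f f}" for y
    using that K by (auto simp: prec_above_def intro: represents_le)
  fix u assume u: "\<forall>y\<in>{Fin (\<pi> f) |f. K \<prec>\<^sub>f f}. u \<le> y"
  have "u \<le> \<mu> V" if V: "open V" "K \<subseteq> V" for V
  proof -
    obtain g W where g: "K \<subseteq> W" "W \<prec>\<^sub>f g" "g \<prec>\<^sub>s V"
      by (rule cc_urysohn[OF lc K V]) (rule that)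
    have "u \<le> Fin (\<pi> g)" using u prec_above_mono[OF g(1,2)] by blast
    also have "\<dots> \<le> \<mu> V" using represents_open[OF V(1)] g(3) unfolding isLub_UNIV_iff by blast
    finally show ?thesis .
  qed
  then show "u \<le> \<mu> K"
    using represents_outer[OF borel_compact[OF K]] unfolding isGlb_UNIV_iff by blast
qed

end

text \<open>\<open>\<pi>\<close> determines the values on open sets, and outer regularity those on
  Borel sets. Elsewhere both maps are \<open>undefined\<close>, being elements of a
  \<open>PiE\<close>.\<close>

lemma represents_unique:
  assumes \<mu>: "represents \<mu> \<pi>" and \<nu>: "represents \<nu> \<pi>"
  shows "\<mu> = \<nu>"
proof (rule PiE_ext[of _ "sets borel" "\<lambda>_. {0..}"])
  show "\<mu> \<in> sets borel \<rightarrow>\<^sub>E {0..}" "\<nu> \<in> sets borel \<rightarrow>\<^sub>E {0..}"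
    using represents_positive_measure[OF \<mu>] represents_positive_measure[OF \<nu>]
    by (simp_all add: positive_measure_def)
  have "\<mu> V = \<nu> V" if "open V" for V
    using isLub_UNIV_unique[OF represents_open[OF \<mu> that] represents_open[OF \<nu> that]] .
  then have eq: "{\<mu> V |V. open V \<and> A \<subseteq> V} = {\<nu> V |V. open V \<and> A \<subseteq> V}" for A by metis
  show "\<mu> A = \<nu> A" if "A \<in> sets borel" for A
    using isGlb_UNIV_unique[OF represents_outer[OF \<mu> that, unfolded eq] represents_outer[OF \<nu> that]] .
qed

section \<open>Completeness of a normed vector lattice\<close>

text \<open>\<open>summable_bound\<close> provides an order supremum of the partial sums, and order
  continuity of the norm makes it their limit in norm.\<close>

lemma nonneg_series_convergent:
  fixes x :: "nat \<Rightarrow> 'e"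
  assumes "\<And>n. 0 \<le> x n" "summable (\<lambda>n. norm (x n))"
  shows "convergent (\<lambda>N. \<Sum>n\<le>N. x n)"
proof -
  let ?S = "\<lambda>N. \<Sum>n\<le>N. x n"
  obtain s where "isLub UNIV (range (\<lambda>N. Fin (?S N))) (Fin s)"
    using summable_bound[OF assms] by blast
  then have s: "isLub UNIV (range ?S) s"
    by (subst isLub_Fin_iff[symmetric]) (simp add: image_image)
  have inc: "incseq ?S" using assms(1) by (auto simp: incseq_def intro!: sum_mono2)
  have "?S \<longlonglongrightarrow> s"
  proof (rule LIMSEQ_I)
    fix \<epsilon> :: real assume "0 < \<epsilon>"
    then obtain a where a: "a \<in> range ?S" "\<forall>b\<in>range ?S. a \<le> b \<longrightarrow> norm (s - b) < \<epsilon>"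
      using upward_sup_norm[OF upward_incseq[OF inc] s] by blast
    then obtain N where N: "a = ?S N" by blast
    have "norm (?S n - s) < \<epsilon>" if "N \<le> n" for n
      using a(2) incseqD[OF inc that] unfolding N by (simp add: norm_minus_commute)
    then show "\<exists>N. \<forall>n\<ge>N. norm (?S n - s) < \<epsilon>" by blast
  qed
  then show ?thesis by (auto simp: convergent_def)
qed

text \<open>The increments \<open>d k\<close> of a rapidly Cauchy subsequence have no sign. Each is
  the difference of \<open>p k\<close> and \<open>p k - d k\<close>, which are positive with
  summable norms, so both series converge by \<open>nonneg_series_convergent\<close>.\<close>

lemma normed_vector_lattice_complete:
  assumes E: "normed_vector_lattice TYPE('e)"
  shows "complete (UNIV :: 'e set)"
  unfolding complete_def
proof (intro allI impI)
  fix y :: "nat \<Rightarrow> 'e" assume "(\<forall>n. y n \<in> UNIV) \<and> Cauchy y"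
  then have y: "Cauchy y" by blast
  have "\<exists>N. \<forall>m\<ge>N. \<forall>n\<ge>N. norm (y m - y n) < (1/2) ^ k" for k
    using CauchyD[OF y, of "(1/2) ^ k"] by simp
  then obtain N where N: "\<And>k m n. N k \<le> m \<Longrightarrow> N k \<le> n \<Longrightarrow> norm (y m - y n) < (1/2) ^ k" by metis
  \<comment> \<open>The sum makes \<open>r j\<close> at least \<open>N k\<close> for all
    \<open>k \<le> j\<close>; the summand \<open>k\<close> makes \<open>r\<close> strictly
    increasing.\<close>
  define r where "r k = k + (\<Sum>i\<le>k. N i)" for k
  have r: "strict_mono r" by (rule strict_monoI_Suc) (simp add: r_def)
  have rN: "N k \<le> r j" if "k \<le> j" for k j
    using member_le_sum[of k "{..j}" N] that by (simp add: r_def)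
  define d where "d k = y (r (Suc k)) - y (r k)" for k
  have d: "norm (d k) < (1/2) ^ k" for k unfolding d_def by (intro N rN) auto
  have "\<exists>p. 0 \<le> p \<and> d k \<le> p \<and> norm p \<le> norm (d k)" for k
    using normed_vector_lattice_pos_part[OF E, of "d k"] by blast
  then obtain p where p: "\<And>k. 0 \<le> p k" "\<And>k. d k \<le> p k" "\<And>k. norm (p k) \<le> norm (d k)" by metis
  \<comment> \<open>The factor 2 is for \<open>p k - d k\<close>, whose norm is at most that of
    \<open>p k\<close> plus that of \<open>d k\<close>.\<close>
  have sum: "summable (\<lambda>k. 2 * (1/2 :: real) ^ k)" by (intro summable_mult summable_geometric) simp
  have "convergent (\<lambda>n. \<Sum>k\<le>n. p k)"
  proof (rule nonneg_series_convergent[OF p(1)])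
    have "norm (p k) \<le> 2 * (1/2) ^ k" for k using p(3)[of k] d[of k] norm_ge_zero[of "d k"] by linarith
    then show "summable (\<lambda>k. norm (p k))" by (intro summable_comparison_test'[OF sum]) simp
  qed
  moreover have "convergent (\<lambda>n. \<Sum>k\<le>n. p k - d k)"
  proof (rule nonneg_series_convergent)
    show "0 \<le> p k - d k" for k using p(2) by simp
    have "norm (p k - d k) \<le> 2 * (1/2) ^ k" for k
      using norm_triangle_ineq4[of "p k" "d k"] p(3)[of k] d[of k] by linarith
    then show "summable (\<lambda>k. norm (p k - d k))" by (intro summable_comparison_test'[OF sum]) simp
  qed
  ultimately have "convergent (\<lambda>n. y (r 0) + ((\<Sum>k\<le>n. p k) - (\<Sum>k\<le>n. p k - d k)))"
    by (intro convergent_add convergent_diff convergent_const)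
  moreover have "y (r 0) + ((\<Sum>k\<le>n. p k) - (\<Sum>k\<le>n. p k - d k)) = y (r (Suc n))" for n
    using sum_lessThan_telescope[of "\<lambda>k. y (r k)" "Suc n"]
    by (simp add: d_def lessThan_Suc_atMost flip: sum_subtractf)
  ultimately obtain l where "(\<lambda>n. y (r (Suc n))) \<longlonglongrightarrow> l" by (auto simp: convergent_def)
  then have "(y \<circ> r) \<longlonglongrightarrow> l" by (simp add: filterlim_sequentially_Suc[of "\<lambda>n. y (r n)"] o_def)
  then have "y \<longlonglongrightarrow> l" by (rule Cauchy_converges_subseq[OF y r])
  then show "\<exists>l\<in>UNIV. y \<longlonglongrightarrow> l" by blast
qed

section \<open>Finite measures\<close>

text \<open>The support condition is void on \<open>UNIV\<close>, so the boundedness criterion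
  becomes the formula for the measure of an open set, applied to the whole space.\<close>

lemma unit_ball_below: "{\<pi> f |f. 0 \<le> f \<and> norm f \<le> 1} = below UNIV"
proof -
  have "0 \<le> f \<and> norm f \<le> 1 \<longleftrightarrow> f \<prec>\<^sub>s UNIV" for f :: "'x cc"
  proof
    assume f: "0 \<le> f \<and> norm f \<le> 1"
    have "0 \<le> apply_cc f x \<and> apply_cc f x \<le> 1" for x
      using f cc_abs_le_norm[of f x] by (auto simp: less_eq_cc.rep_eq zero_cc.rep_eq)
    then show "f \<prec>\<^sub>s UNIV" by (simp add: prec_below_def)
  next
    assume "f \<prec>\<^sub>s UNIV"
    then show "0 \<le> f \<and> norm f \<le> 1"
      by (auto simp: prec_below_def less_eq_cc.rep_eq zero_cc.rep_eq intro!: cc_norm_le)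
  qed
  then show ?thesis by simp
qed

lemma bounded_linear_if_norm_le: "(\<And>f. norm (\<pi> f) \<le> C * norm f) \<Longrightarrow> bounded_linear \<pi>"
  by (rule bounded_linear_intro[of _ C]) (simp_all add: add scale mult.commute)

lemma finite_iff_bounded:
  assumes "represents \<mu> \<pi>"
  shows "is_finite (\<mu> UNIV) \<longleftrightarrow> bdd_above (below UNIV)"
proof -
  have lub: "isLub UNIV {Fin (\<pi> f) |f. f \<prec>\<^sub>s UNIV} (\<mu> UNIV)"
    by (rule represents_open[OF assms open_UNIV])
  show ?thesis
  proof
    assume "is_finite (\<mu> UNIV)"
    then obtain m where m: "\<mu> UNIV = Fin m" by (cases "\<mu> UNIV") auto
    have "\<pi> f \<le> m" if "f \<prec>\<^sub>s UNIV" for f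
    proof -
      have "Fin (\<pi> f) \<le> Fin m" using lub that unfolding isLub_UNIV_iff m by blast
      then show ?thesis by simp
    qed
    then show "bdd_above (below UNIV)" unfolding bdd_above_def by blast
  next
    assume "bdd_above (below UNIV)"
    then obtain b where "\<forall>y\<in>below UNIV. y \<le> b" unfolding bdd_above_def by blast
    then have "\<forall>y\<in>{Fin (\<pi> f) |f. f \<prec>\<^sub>s UNIV}. y \<le> Fin b" by auto
    then have "\<mu> UNIV \<le> Fin b" using lub unfolding isLub_UNIV_iff by blast
    then show "is_finite (\<mu> UNIV)" by (auto simp: le_Fin_iff)
  qed
qed

context
  fixes \<mu> :: "'x set \<Rightarrow> 'e with_inf" and m :: 'e
  assumes \<mu>: "represents \<mu> \<pi>" and m: "\<mu> UNIV = Fin m"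
begin

lemma total_lub: "isLub UNIV (below UNIV) m"
proof -
  have "{Fin (\<pi> f) |f. f \<prec>\<^sub>s UNIV} = Fin ` below UNIV" by blast
  then have "isLub UNIV (Fin ` below UNIV) (Fin m)"
    using represents_open[OF \<mu> open_UNIV] m by simp
  then show ?thesis by (simp only: isLub_Fin_iff)
qed

lemma le_norm_total:
  assumes "0 \<le> g"
  shows "\<pi> g \<le> norm g *\<^sub>R m"
proof (cases "norm g = 0")
  case True
  then show ?thesis by (simp add: zero)
next
  case False
  let ?h = "inverse (norm g) *\<^sub>R g"
  have "0 \<le> ?h" using assms by (simp add: scaleR_nonneg_nonneg)
  moreover have "norm ?h \<le> 1" using False by simp
  ultimately have "\<pi> ?h \<in> below UNIV" unfolding unit_ball_below[symmetric] by blast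
  then have "\<pi> ?h \<le> m" using total_lub unfolding isLub_UNIV_iff by blast
  then have "norm g *\<^sub>R \<pi> ?h \<le> norm g *\<^sub>R m" by (intro scaleR_left_mono) auto
  then show ?thesis using False by (simp add: scale)
qed

lemma total_nonneg: "0 \<le> m"
proof -
  have "\<pi> 0 \<in> below UNIV" using zero_prec_below by blast
  then have "\<pi> 0 \<le> m" using total_lub unfolding isLub_UNIV_iff by blast
  then show ?thesis by (simp add: zero)
qed

text \<open>Both parts of \<open>f\<close> have norm at most \<open>norm f\<close>. The two norm
  estimates for \<open>\<pi>\<close> start from here.\<close>

lemma pos_neg_parts:
  obtains fp fn where "f = fp - fn" "0 \<le> \<pi> fp" "\<pi> fp \<le> norm f *\<^sub>R m" "0 \<le> \<pi> fn" "\<pi> fn \<le> norm f *\<^sub>R m"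
proof -
  have part: "\<exists>g. (\<forall>x. apply_cc g x = max (apply_cc h x) 0) \<and> 0 \<le> \<pi> g \<and> \<pi> g \<le> norm h *\<^sub>R m" for h :: "'x cc"
  proof -
    obtain g where g: "\<forall>x. apply_cc g x = max (apply_cc h x) 0" using cc_pos_part by blast
    have "0 \<le> g" by (simp add: less_eq_cc.rep_eq zero_cc.rep_eq g)
    have "\<bar>apply_cc g x\<bar> \<le> norm h" for x using cc_abs_le_norm[of h x] by (simp add: g)
    then have "norm g \<le> norm h" by (rule cc_norm_le)
    then have "norm g *\<^sub>R m \<le> norm h *\<^sub>R m" using total_nonneg by (intro scaleR_right_mono)
    with le_norm_total[OF \<open>0 \<le> g\<close>] have "\<pi> g \<le> norm h *\<^sub>R m" by (rule order_trans)
    with g nonneg[OF \<open>0 \<le> g\<close>] show ?thesis by blast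
  qed
  obtain fp where fp: "\<forall>x. apply_cc fp x = max (apply_cc f x) 0" "0 \<le> \<pi> fp" "\<pi> fp \<le> norm f *\<^sub>R m"
    using part by blast
  obtain fn where fn: "\<forall>x. apply_cc fn x = max (apply_cc (- f) x) 0" "0 \<le> \<pi> fn" "\<pi> fn \<le> norm (- f) *\<^sub>R m"
    using part by blast
  have "f = fp - fn" by (rule cc_eqI) (simp add: minus_cc.rep_eq uminus_cc.rep_eq fp(1) fn(1))
  then show thesis using fp(2,3) fn(2,3) unfolding norm_minus_cancel by (rule that)
qed

text \<open>A monotone norm controls the images of the two parts separately, and the triangle
  inequality adds them: this is the factor 2.\<close>

lemma norm_le_monotone:
  assumes mono: "norm_monotone_on_cone TYPE('e)"
  shows "norm (\<pi> f) \<le> 2 * norm m * norm f"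
proof -
  obtain fp fn where f: "f = fp - fn" "0 \<le> \<pi> fp" "\<pi> fp \<le> norm f *\<^sub>R m" "0 \<le> \<pi> fn" "\<pi> fn \<le> norm f *\<^sub>R m"
    by (rule pos_neg_parts)
  have "norm (\<pi> fp) \<le> norm (norm f *\<^sub>R m)" "norm (\<pi> fn) \<le> norm (norm f *\<^sub>R m)"
    using mono f(2-5) unfolding norm_monotone_on_cone_def by blast+
  moreover have "norm (\<pi> f) \<le> norm (\<pi> fp) + norm (\<pi> fn)"
    using norm_triangle_ineq4[of "\<pi> fp" "\<pi> fn"] diff[of fp fn] f(1) by simp
  ultimately have "norm (\<pi> f) \<le> 2 * (norm f * norm m)" by simp
  then show ?thesis by (simp only: mult_ac)
qed

text \<open>In a lattice \<open>norm f *\<^sub>R m\<close> dominates the absolute value of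
  \<open>\<pi> f\<close>, so the two parts are not added and no factor 2 arises.\<close>

lemma norm_le_lattice:
  assumes E: "normed_vector_lattice TYPE('e)"
  shows "norm (\<pi> f) \<le> norm m * norm f"
proof -
  obtain fp fn where f: "f = fp - fn" "0 \<le> \<pi> fp" "\<pi> fp \<le> norm f *\<^sub>R m" "0 \<le> \<pi> fn" "\<pi> fn \<le> norm f *\<^sub>R m"
    by (rule pos_neg_parts)
  have eq: "\<pi> f = \<pi> fp - \<pi> fn" using diff[of fp fn] f(1) by simp
  have "\<pi> f \<le> \<pi> fp" "- \<pi> f \<le> \<pi> fn" unfolding eq using f(2,4) by simp_all
  then have "\<pi> f \<le> norm f *\<^sub>R m" "- \<pi> f \<le> norm f *\<^sub>R m"
    using f(3,5) by (blast intro: order_trans)+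
  then have "norm (\<pi> f) \<le> norm (norm f *\<^sub>R m)" by (rule normed_vector_lattice_norm_bound[OF E])
  then show ?thesis by (simp add: mult.commute)
qed

text \<open>For the lower bound, \<open>m\<close> is the supremum of the directed set of images of
  positive functions in the unit ball, hence a norm limit of such images.\<close>

lemma onorm_lattice:
  assumes E: "normed_vector_lattice TYPE('e)"
  shows "onorm \<pi> = norm m"
proof (rule antisym)
  show "onorm \<pi> \<le> norm m" by (rule onorm_bound) (auto simp: norm_le_lattice[OF E])
  have bl: "bounded_linear \<pi>" by (rule bounded_linear_if_norm_le[OF norm_le_lattice[OF E]])
  show "norm m \<le> onorm \<pi>"
  proof (rule field_le_epsilon)
    fix \<epsilon> :: real assume "0 < \<epsilon>"
    obtain a where a: "a \<in> below UNIV" "norm (m - a) < \<epsilon>"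
      using upward_sup_norm[OF below_upward total_lub \<open>0 < \<epsilon>\<close>] by blast
    then obtain f where f: "0 \<le> f \<and> norm f \<le> 1" "a = \<pi> f" unfolding unit_ball_below[symmetric] by blast
    have "norm (\<pi> f) \<le> onorm \<pi> * norm f" by (rule onorm[OF bl])
    also have "\<dots> \<le> onorm \<pi>" using f(1) onorm_pos_le[OF bl] by (simp add: mult_left_le)
    finally have "norm (\<pi> f) \<le> onorm \<pi>" .
    moreover have "norm m \<le> norm (m - a) + norm a" using norm_triangle_ineq[of "m - a" a] by simp
    ultimately show "norm m \<le> onorm \<pi> + \<epsilon>" using a(2) f(2) by simp
  qed
qed

end

text \<open>On a compact space the constant 1 has compact support, and its image is the
  bound.\<close>

lemma compact_space_bounded:
  assumes "compact (UNIV :: 'x set)"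
  shows "bdd_above (below UNIV)"
proof -
  obtain g W where "(UNIV :: 'x set) \<subseteq> W" "W \<prec>\<^sub>f g"
    by (rule cc_urysohn[OF lc assms open_UNIV subset_UNIV]) (rule that)
  then have g: "apply_cc g x = 1" for x by (auto simp: prec_above_def)
  have "\<pi> f \<le> \<pi> g" if "f \<prec>\<^sub>s UNIV" for f
    using that by (intro mono) (simp add: less_eq_cc.rep_eq g prec_below_def)
  then show ?thesis unfolding bdd_above_def by blast
qed

end

theorem theorem4p2:
  fixes \<pi> :: "'x::t2_space cc \<Rightarrow> 'e::{ordered_real_vector,real_normed_vector}"
  assumes "monotone_complete TYPE('e)"
    and "norm_order_continuous TYPE('e)"
    and "\<And>x :: nat \<Rightarrow> 'e. (\<And>n. 0 \<le> x n) \<Longrightarrow> summable (\<lambda>n. norm (x n)) \<Longrightarrow>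
           \<exists>s. isLub UNIV (range (\<lambda>N. Fin (\<Sum>n\<le>N. x n))) (Fin s)"
    and "\<And>x :: 'e. (\<And>x' :: 'e \<Rightarrow> real. bounded_linear x' \<Longrightarrow> positive_operator x' \<Longrightarrow>
           \<sigma>_order_continuous x' \<Longrightarrow> 0 \<le> x' x) \<Longrightarrow> 0 \<le> x"
    and "locally_compact_space (euclidean :: 'x topology)"
    and "positive_operator \<pi>"
  shows "(\<exists>!\<mu>. represents \<mu> \<pi>) \<and>
    (\<forall>\<mu>. represents \<mu> \<pi> \<longrightarrow>
      (\<forall>V. open V \<and> V \<noteq> {} \<longrightarrow> isLub UNIV {Fin (\<pi> f) |f. f \<prec>\<^sub>s V} (\<mu> V)) \<and>
      (\<forall>K. compact K \<longrightarrow> isGlb UNIV {Fin (\<pi> f) |f. K \<prec>\<^sub>f f} (\<mu> K)) \<and>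
      (is_finite (\<mu> UNIV) \<longleftrightarrow> bdd_above {\<pi> f |f. 0 \<le> f \<and> norm f \<le> 1}) \<and>
      (compact (UNIV :: 'x set) \<longrightarrow> bdd_above {\<pi> f |f. 0 \<le> f \<and> norm f \<le> 1}) \<and>
      (is_finite (\<mu> UNIV) \<and> norm_monotone_on_cone TYPE('e) \<longrightarrow>
        continuous_on UNIV \<pi> \<and> onorm \<pi> \<le> 2 * norm (fin_part (\<mu> UNIV))) \<and>
      (is_finite (\<mu> UNIV) \<and> normed_vector_lattice TYPE('e) \<longrightarrow>
        banach_lattice TYPE('e) \<and> norm_order_continuous TYPE('e) \<and>
        onorm \<pi> = norm (fin_part (\<mu> UNIV))))"
proof -
  interpret positive_cc_operator "TYPE('e)" \<pi>
    by (unfold_locales) (fact assms)+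
  show ?thesis
    unfolding unit_ball_below
  proof (intro conjI allI impI)
    show "\<exists>!\<mu>. represents \<mu> \<pi>"
      using represents_riesz_measure represents_unique by blast
  next
    fix \<mu> assume \<mu>: "represents \<mu> \<pi>"
    show "isLub UNIV {Fin (\<pi> f) |f. f \<prec>\<^sub>s V} (\<mu> V)" if "open V \<and> V \<noteq> {}" for V
      using represents_open[OF \<mu>] that by blast
    show "isGlb UNIV {Fin (\<pi> f) |f. K \<prec>\<^sub>f f} (\<mu> K)" if "compact K" for K
      using represents_compact[OF \<mu> that] .
    show "is_finite (\<mu> UNIV) \<longleftrightarrow> bdd_above (below UNIV)"
      by (rule finite_iff_bounded[OF \<mu>])
    show "bdd_above (below UNIV)" if "compact (UNIV :: 'x set)"
      by (rule compact_space_bounded[OF that])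
    have m: "\<mu> UNIV = Fin (fin_part (\<mu> UNIV))" if "is_finite (\<mu> UNIV)"
      using that by simp
    {
      assume *: "is_finite (\<mu> UNIV) \<and> norm_monotone_on_cone TYPE('e)"
      note le = norm_le_monotone[OF \<mu> m[OF conjunct1[OF *]] conjunct2[OF *]]
      show "continuous_on UNIV \<pi>"
        by (rule linear_continuous_on[OF bounded_linear_if_norm_le[OF le]])
      show "onorm \<pi> \<le> 2 * norm (fin_part (\<mu> UNIV))"
        by (rule onorm_bound[OF _ le]) simp
    next
      assume *: "is_finite (\<mu> UNIV) \<and> normed_vector_lattice TYPE('e)"
      show "banach_lattice TYPE('e)"
        using * normed_vector_lattice_complete by (simp add: banach_lattice_def)
      show "norm_order_continuous TYPE('e)" by (rule assms(2))
      show "onorm \<pi> = norm (fin_part (\<mu> UNIV))"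
        by (rule onorm_lattice[OF \<mu> m[OF conjunct1[OF *]] conjunct2[OF *]])
    }
  qed
qed

end
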